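(* Suppose that $n\geq 1$ and that $E(R,S)$ is a formula in the signature of $\mathsf{SO}+\mathsf{GC}$, with exactly two free variables $R,S$, both $n$-ary concept variables, such that $\mathsf{SO}+\mathsf{GC}$ proves that $E$ is an equivalence relation on $n$-ary concepts. Then the theory $\Sigma^1_1\text{-}[E]\mathsf{A}+\mathsf{SO}+\mathsf{GC}$ is consistent.
   Context: **Language of pure second-order logic.** Many-sorted: one sort of objects and, for each $n\ge 1$, a sort of $n$-ary concepts. The signature of $\mathsf{SO}$ consists of the predication relations $R(a_1,\dots,a_n)$ and, for all $m,n>0$, the function symbols $(R,a_1,\dots,a_n)\mapsto R[a_1,\dots,a_n]$ taking an $(n+m)$-ary concept and $n$ objects to the $m$-ary concept $\{(y_1,\dots,y_m):R(a_1,\dots,a_n,y_1,\dots,y_m)\}$. Concept quantifiers are called second-order; semantics is Henkin semantics (ordinary many-sorted first-order logic). Identity of concepts is extensional. **$\mathsf{SO}$** consists of the extensionality axioms and the Full Comprehension Schema in its signature: $\exists R\,\forall\overline a\,(R\overline a\leftrightarrow\varphi(\overline a))$ for every formula $\varphi(\overline x)$, possibly with object and concept parameters, with $R$ not free in $\varphi$. **$\mathsf{GC}$**: for a theory $T$, $T+\mathsf{GC}$ expands the signature by a binary relation symbol $<$ on objects, adds axioms saying that $<$ is a linear order of the objects, and adds the schema $[\exists x\,\varphi(x)]\to[\exists x\,(\varphi(x)\wedge\forall y<x\,\neg\varphi(y))]$ for all formulas $\varphi(x)$ ($x$ an object variable) of the expanded signature, possibly with parameters. The comprehension and choice schemata of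 $T$ are allowed to use $<$; in particular, in $\mathsf{SO}+\mathsf{GC}$ the Full Comprehension Schema covers all formulas of the signature of $\mathsf{SO}$ together with $<$. **Abstraction principle.** $A[E]$ is the axiom $\forall R,S\,[\partial_E(R)=\partial_E(S)\leftrightarrow E(R,S)]$, in a signature expanded by a new function symbol $\partial_E$ from $n$-ary concepts to objects. **$\Sigma^1_1\text{-}[E]\mathsf{A}$** consists of $A[E]$ together with the following two schemata in the signature containing $\partial_E$. *First-Order Comprehension Schema*: $\exists R\,\forall\overline a\,(R\overline a\leftrightarrow\varphi(\overline a))$ for all $\varphi$ without second-order quantifiers, possibly with parameters, $R$ not free in $\varphi$. *$\Sigma^1_1$-Choice Schema*: $[\forall\overline x\,\exists R'\,\varphi(\overline x,R')]\to\exists R\,\forall\overline x\,\varphi(\overline x,R[\overline x])$ for every $\Sigma^1_1$-formula $\varphi$ (a block of existential concept quantifiers followed by a formula with no second-order quantifiers), possibly with parameters, where $\overline x$ is a $p$-tuple of object variables, $R'$ is $q$-ary, $R$ is $(p+q)$-ary and not free in $\varphi$ ($p,q\ge1$). The combined theory $\Sigma^1_1\text{-}[E]\mathsf{A}+\mathsf{SO}+\mathsf{GC}$ has full comprehension for formulas in the signature of $\mathsf{SO}+\mathsf{GC}$, but only the First-Order Comprehension and $\Sigma^1_1$-Choice Schemata (and the $\mathsf{GC}$ schema) for formulas in the full signature including $\partial_E$ and $<$. *)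

theory Defs
  imports Main
begin

section \<open>Many-sorted syntax\<close>

text \<open>\<open>Con k\<close> is the sort of \<open>k\<close>-ary concepts; only \<open>k \<ge> 1\<close> is admitted (\<open>valid_sort\<close>).
  A variable is a sort together with a name. \<open>Section T [a1,\<dots>,an]\<close> is \<open>T[a1,\<dots>,an]\<close>, where the
  symbol meant (its \<open>n\<close> and \<open>m\<close>) is determined by the length of the list and the sort of \<open>T\<close>;
  \<open>Abstr T\<close> is \<open>\<partial>(T)\<close>.\<close>

datatype sort = Obj | Con nat

fun valid_sort :: "sort \<Rightarrow> bool" where
  "valid_sort Obj = True"
| "valid_sort (Con k) = (k \<ge> 1)"

type_synonym var = "sort \<times> nat"

datatype trm = Var var | Section trm "trm list" | Abstr trm

datatype fm =
    Eq trm trm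
  | Less trm trm
  | Pred trm "trm list"
  | Fls
  | Imp fm fm
  | Forall var fm

definition Neg :: "fm \<Rightarrow> fm" where "Neg A = Imp A Fls"
definition Conj :: "fm \<Rightarrow> fm \<Rightarrow> fm" where "Conj A B = Neg (Imp A (Neg B))"
definition Disj :: "fm \<Rightarrow> fm \<Rightarrow> fm" where "Disj A B = Imp (Neg A) B"
definition Iff :: "fm \<Rightarrow> fm \<Rightarrow> fm" where "Iff A B = Conj (Imp A B) (Imp B A)"
definition Exists :: "var \<Rightarrow> fm \<Rightarrow> fm" where "Exists v A = Neg (Forall v (Neg A))"

definition Foralls :: "var list \<Rightarrow> fm \<Rightarrow> fm" where "Foralls vs A = foldr Forall vs A"

abbreviation ovar :: "nat \<Rightarrow> var" where "ovar x \<equiv> (Obj, x)"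
abbreviation cvar :: "nat \<Rightarrow> nat \<Rightarrow> var" where "cvar k R \<equiv> (Con k, R)"

text \<open>A signature is the signature of \<open>SO\<close>, possibly expanded by \<open><\<close> and possibly by a function
  symbol \<open>\<partial>\<close> from \<open>n\<close>-ary concepts to objects (\<open>abstr_arity = Some n\<close>).\<close>

datatype signature = Signature (has_less: bool) (abstr_arity: "nat option")

inductive has_sort :: "signature \<Rightarrow> trm \<Rightarrow> sort \<Rightarrow> bool" for L where
  Var: "valid_sort s \<Longrightarrow> has_sort L (Var (s, x)) s"
| Section: "\<lbrakk>has_sort L T (Con k); ts \<noteq> []; length ts < k; \<forall>t\<in>set ts. has_sort L t Obj\<rbrakk>
    \<Longrightarrow> has_sort L (Section T ts) (Con (k - length ts))"
| Abstr: "\<lbrakk>abstr_arity L = Some n; has_sort L T (Con n)\<rbrakk> \<Longrightarrow> has_sort L (Abstr T) Obj"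

primrec wff :: "signature \<Rightarrow> fm \<Rightarrow> bool" where
  "wff L (Eq t u) = (\<exists>s. has_sort L t s \<and> has_sort L u s)"
| "wff L (Less t u) = (has_less L \<and> has_sort L t Obj \<and> has_sort L u Obj)"
| "wff L (Pred T ts) = (has_sort L T (Con (length ts)) \<and> (\<forall>t\<in>set ts. has_sort L t Obj))"
| "wff L Fls = True"
| "wff L (Imp A B) = (wff L A \<and> wff L B)"
| "wff L (Forall v A) = (valid_sort (fst v) \<and> wff L A)"

primrec fvt :: "trm \<Rightarrow> var set" where
  "fvt (Var v) = {v}"
| "fvt (Section T ts) = fvt T \<union> \<Union>(set (map fvt ts))"
| "fvt (Abstr T) = fvt T"

primrec fv :: "fm \<Rightarrow> var set" where
  "fv (Eq t u) = fvt t \<union> fvt u"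
| "fv (Less t u) = fvt t \<union> fvt u"
| "fv (Pred T ts) = fvt T \<union> \<Union>(set (map fvt ts))"
| "fv Fls = {}"
| "fv (Imp A B) = fv A \<union> fv B"
| "fv (Forall v A) = fv A - {v}"

section \<open>Simultaneous capture-avoiding substitution\<close>

text \<open>A bound variable is renamed only if it would capture, so whenever the terms are free for the
  variables they replace, this is the usual literal replacement.\<close>

definition avoid :: "var set \<Rightarrow> var \<Rightarrow> var" where
  "avoid X v = (if v \<in> X then (fst v, LEAST i. (fst v, i) \<notin> X) else v)"

primrec substt :: "(var \<Rightarrow> trm) \<Rightarrow> trm \<Rightarrow> trm" where
  "substt \<sigma> (Var v) = \<sigma> v"
| "substt \<sigma> (Section T ts) = Section (substt \<sigma> T) (map (substt \<sigma>) ts)"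
| "substt \<sigma> (Abstr T) = Abstr (substt \<sigma> T)"

primrec subst :: "fm \<Rightarrow> (var \<Rightarrow> trm) \<Rightarrow> fm" where
  "subst (Eq t u) = (\<lambda>\<sigma>. Eq (substt \<sigma> t) (substt \<sigma> u))"
| "subst (Less t u) = (\<lambda>\<sigma>. Less (substt \<sigma> t) (substt \<sigma> u))"
| "subst (Pred T ts) = (\<lambda>\<sigma>. Pred (substt \<sigma> T) (map (substt \<sigma>) ts))"
| "subst Fls = (\<lambda>\<sigma>. Fls)"
| "subst (Imp A B) = (\<lambda>\<sigma>. Imp (subst A \<sigma>) (subst B \<sigma>))"
| "subst (Forall v A) = (\<lambda>\<sigma>.
     let w = avoid (\<Union>u \<in> fv A - {v}. fvt (\<sigma> u)) v
     in Forall w (subst A (\<sigma>(v := Var w))))"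

definition subst1 :: "fm \<Rightarrow> var \<Rightarrow> trm \<Rightarrow> fm" where
  "subst1 A v t = subst A (Var(v := t))"

section \<open>Provability and consistency\<close>

text \<open>A Hilbert calculus for many-sorted first-order logic with identity, in the style of Mendelson.
  Generalization is unrestricted, so the free variables of nonlogical axioms are read universally;
  this is how parameters in the schemata below are treated. All sorts are taken to be nonempty.\<close>

inductive proves :: "signature \<Rightarrow> fm set \<Rightarrow> fm \<Rightarrow> bool" for L \<Gamma> where
  Ax: "A \<in> \<Gamma> \<Longrightarrow> proves L \<Gamma> A"
| K: "\<lbrakk>wff L A; wff L B\<rbrakk> \<Longrightarrow> proves L \<Gamma> (Imp A (Imp B A))"
| S: "\<lbrakk>wff L A; wff L B; wff L C\<rbrakk>
    \<Longrightarrow> proves L \<Gamma> (Imp (Imp A (Imp B C)) (Imp (Imp A B) (Imp A C)))"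
| DN: "wff L A \<Longrightarrow> proves L \<Gamma> (Imp (Neg (Neg A)) A)"
| Inst: "\<lbrakk>wff L (Forall v A); has_sort L t (fst v)\<rbrakk>
    \<Longrightarrow> proves L \<Gamma> (Imp (Forall v A) (subst1 A v t))"
| Distr: "\<lbrakk>wff L (Forall v (Imp A B)); v \<notin> fv A\<rbrakk>
    \<Longrightarrow> proves L \<Gamma> (Imp (Forall v (Imp A B)) (Imp A (Forall v B)))"
| Refl: "has_sort L t s \<Longrightarrow> proves L \<Gamma> (Eq t t)"
| Leibniz: "\<lbrakk>wff L A; has_sort L t (fst v); has_sort L u (fst v)\<rbrakk>
    \<Longrightarrow> proves L \<Gamma> (Imp (Eq t u) (Imp (subst1 A v t) (subst1 A v u)))"
| MP: "\<lbrakk>proves L \<Gamma> (Imp A B); proves L \<Gamma> A\<rbrakk> \<Longrightarrow> proves L \<Gamma> B"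
| Gen: "\<lbrakk>proves L \<Gamma> A; valid_sort (fst v)\<rbrakk> \<Longrightarrow> proves L \<Gamma> (Forall v A)"

definition consistent :: "signature \<Rightarrow> fm set \<Rightarrow> bool" where
  "consistent L \<Gamma> \<longleftrightarrow> \<not> proves L \<Gamma> Fls"

section \<open>The theories SO and SO + GC\<close>

abbreviation ovars :: "nat list \<Rightarrow> var list" where "ovars xs \<equiv> map ovar xs"
abbreviation oterms :: "nat list \<Rightarrow> trm list" where "oterms xs \<equiv> map (\<lambda>x. Var (ovar x)) xs"

definition extensionality :: "nat \<Rightarrow> fm" where
  "extensionality k =
     Foralls [cvar k 0, cvar k 1]
       (Imp (Foralls (ovars [0..<k])
               (Iff (Pred (Var (cvar k 0)) (oterms [0..<k]))
                    (Pred (Var (cvar k 1)) (oterms [0..<k]))))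
            (Eq (Var (cvar k 0)) (Var (cvar k 1))))"

text \<open>\<open>R[a1,\<dots>,an] = {(y1,\<dots>,ym) : R(a1,\<dots>,an,y1,\<dots>,ym)}\<close> for \<open>R\<close> of arity \<open>n + m\<close>.\<close>

definition section_axiom :: "nat \<Rightarrow> nat \<Rightarrow> fm" where
  "section_axiom n m =
     Forall (cvar (n + m) 0) (Foralls (ovars [0..<n + m])
       (Iff (Pred (Section (Var (cvar (n + m) 0)) (oterms [0..<n])) (oterms [n..<n + m]))
            (Pred (Var (cvar (n + m) 0)) (oterms [0..<n + m]))))"

definition comprehension_instance :: "nat \<Rightarrow> nat list \<Rightarrow> fm \<Rightarrow> fm" where
  "comprehension_instance R xs A =
     (let k = length xs in
      Exists (cvar k R) (Foralls (ovars xs) (Iff (Pred (Var (cvar k R)) (oterms xs)) A)))"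

definition full_comprehension :: "signature \<Rightarrow> fm set" where
  "full_comprehension L =
     {comprehension_instance R xs A | R xs A.
        xs \<noteq> [] \<and> distinct xs \<and> wff L A \<and> cvar (length xs) R \<notin> fv A}"

definition SO :: "signature \<Rightarrow> fm set" where
  "SO L = {extensionality k | k. k \<ge> 1} \<union> {section_axiom n m | n m. n \<ge> 1 \<and> m \<ge> 1}
          \<union> full_comprehension L"

definition strict_linear_order_axioms :: "fm set" where
  "strict_linear_order_axioms =
     (let x = ovar 0; y = ovar 1; z = ovar 2 in
      {Forall x (Neg (Less (Var x) (Var x))),
       Foralls [x, y, z]
         (Imp (Conj (Less (Var x) (Var y)) (Less (Var y) (Var z))) (Less (Var x) (Var z))),
       Foralls [x, y]
         (Disj (Less (Var x) (Var y)) (Disj (Eq (Var x) (Var y)) (Less (Var y) (Var x))))})"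

definition least_instance :: "var \<Rightarrow> var \<Rightarrow> fm \<Rightarrow> fm" where
  "least_instance x y A =
     Imp (Exists x A)
         (Exists x (Conj A
            (Forall y (Imp (Less (Var y) (Var x)) (Neg (subst1 A x (Var y)))))))"

definition GC :: "signature \<Rightarrow> fm set" where
  "GC L = strict_linear_order_axioms \<union>
     {least_instance (ovar x) (ovar y) A | x y A. x \<noteq> y \<and> wff L A \<and> ovar y \<notin> fv A}"

definition sig_SO_GC :: signature where
  "sig_SO_GC = Signature True None"

definition SO_GC :: "fm set" where
  "SO_GC = SO sig_SO_GC \<union> GC sig_SO_GC"

section \<open>Equivalence formulas and abstraction\<close>

text \<open>\<open>app2 n R S E t u\<close> is \<open>E(t, u)\<close>, for a formula \<open>E(R, S)\<close> in the \<open>n\<close>-ary concept variables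
  named \<open>R\<close> and \<open>S\<close>.\<close>

definition app2 :: "nat \<Rightarrow> nat \<Rightarrow> nat \<Rightarrow> fm \<Rightarrow> trm \<Rightarrow> trm \<Rightarrow> fm" where
  "app2 n R S E t u = subst E (Var(cvar n R := t, cvar n S := u))"

definition equivalence_fm :: "nat \<Rightarrow> nat \<Rightarrow> nat \<Rightarrow> fm \<Rightarrow> fm" where
  "equivalence_fm n R S E =
     (let x = cvar n 0; y = cvar n 1; z = cvar n 2; E' = app2 n R S E in
      Conj (Forall x (E' (Var x) (Var x)))
     (Conj (Foralls [x, y] (Imp (E' (Var x) (Var y)) (E' (Var y) (Var x))))
           (Foralls [x, y, z]
              (Imp (Conj (E' (Var x) (Var y)) (E' (Var y) (Var z))) (E' (Var x) (Var z))))))"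

definition abstraction_axiom :: "nat \<Rightarrow> nat \<Rightarrow> nat \<Rightarrow> fm \<Rightarrow> fm" where
  "abstraction_axiom n R S E =
     Foralls [cvar n R, cvar n S]
       (Iff (Eq (Abstr (Var (cvar n R))) (Abstr (Var (cvar n S)))) E)"

section \<open>First-order comprehension, choice and the combined theory\<close>

primrec first_order :: "fm \<Rightarrow> bool" where
  "first_order (Eq t u) = True"
| "first_order (Less t u) = True"
| "first_order (Pred T ts) = True"
| "first_order Fls = True"
| "first_order (Imp A B) = (first_order A \<and> first_order B)"
| "first_order (Forall v A) = (fst v = Obj \<and> first_order A)"

inductive sigma11 :: "fm \<Rightarrow> bool" where
  "first_order A \<Longrightarrow> sigma11 A"
| "sigma11 A \<Longrightarrow> sigma11 (Exists (cvar k R) A)"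

definition fo_comprehension :: "signature \<Rightarrow> fm set" where
  "fo_comprehension L =
     {comprehension_instance R xs A | R xs A.
        xs \<noteq> [] \<and> distinct xs \<and> wff L A \<and> first_order A \<and> cvar (length xs) R \<notin> fv A}"

definition choice_instance :: "nat \<Rightarrow> nat \<Rightarrow> nat \<Rightarrow> nat list \<Rightarrow> fm \<Rightarrow> fm" where
  "choice_instance q R R' xs A =
     (let r = cvar (length xs + q) R; r' = cvar q R' in
      Imp (Foralls (ovars xs) (Exists r' A))
          (Exists r (Foralls (ovars xs) (subst1 A r' (Section (Var r) (oterms xs))))))"

definition sigma11_choice :: "signature \<Rightarrow> fm set" where
  "sigma11_choice L =
     {choice_instance q R R' xs A | q R R' xs A.
        q \<ge> 1 \<and> xs \<noteq> [] \<and> distinct xs \<and> wff L A \<and> sigma11 A \<and> cvar (length xs + q) R \<notin> fv A}"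

definition sigma11_A :: "signature \<Rightarrow> nat \<Rightarrow> nat \<Rightarrow> nat \<Rightarrow> fm \<Rightarrow> fm set" where
  "sigma11_A L n R S E = {abstraction_axiom n R S E} \<union> fo_comprehension L \<union> sigma11_choice L"

definition sig_full :: "nat \<Rightarrow> signature" where
  "sig_full n = Signature True (Some n)"

text \<open>Full comprehension is confined to formulas without \<open>\<partial>\<close>, whereas first-order comprehension,
  choice and the least-element schema of \<open>GC\<close> (the latter for arbitrary formulas) range over the
  full signature.\<close>

definition sigma11_A_SO_GC :: "nat \<Rightarrow> nat \<Rightarrow> nat \<Rightarrow> fm \<Rightarrow> fm set" where
  "sigma11_A_SO_GC n R S E =
     sigma11_A (sig_full n) n R S E \<union> SO sig_SO_GC \<union> GC (sig_full n)"

end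

(*
  Objects are the natural numbers with their usual order, so GC holds outright. SO + GC is true in
  the full structure, hence E defines an equivalence relation on all n-ary sets; take a countable
  elementary substructure. The operator \<partial> is built generically over it. A condition is a map p from
  sets to numbers that is one-to-one modulo E, with an infinite reserve of unused values. A set is
  covered by p if all its sections are in the domain of p, and the covered sets carry a structure of
  their own. First-order formulas are absolute between these structures and the generic model, so
  the extension of a first-order formula is definable from a single condition. For Sigma^1_1-Choice, a
  fusion argument extends a given condition to one that either satisfies all instances of a
  Sigma^1_1-formula, and then has a choice function, or excludes one instance from every further
  extension.
*)
theory Submission
  imports Defs "HOL-Library.Countable_Set"
begin

section \<open>Henkin structures over the natural numbers\<close>

text \<open>Concepts of all arities share one type and the sorts only filter by list length, so a
  single set \<open>U\<close> serves as universe for every arity. If \<open>{}\<close> is in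
  \<open>U\<close>, it is the empty concept of each arity.\<close>

datatype tv = Ob (ob: nat) | Cn (cn: "nat list set")

definition sec :: "nat list set \<Rightarrow> nat list \<Rightarrow> nat list set" where
  "sec X as = {ys. as @ ys \<in> X}"

primrec val :: "(nat list set \<Rightarrow> nat) \<Rightarrow> (var \<Rightarrow> tv) \<Rightarrow> trm \<Rightarrow> tv" where
  "val ab e (Var v) = e v"
| "val ab e (Section T ts) = Cn (sec (cn (val ab e T)) (map ob (map (val ab e) ts)))"
| "val ab e (Abstr T) = Ob (ab (cn (val ab e T)))"

primrec sdom :: "nat list set set \<Rightarrow> sort \<Rightarrow> tv set" where
  "sdom U Obj = range Ob"
| "sdom U (Con k) = Cn ` {X \<in> U. \<forall>l\<in>X. length l = k}"

primrec sat :: "nat list set set \<Rightarrow> (nat list set \<Rightarrow> nat) \<Rightarrow> fm \<Rightarrow> (var \<Rightarrow> tv) \<Rightarrow> bool" where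
  "sat U ab (Eq t u) = (\<lambda>e. val ab e t = val ab e u)"
| "sat U ab (Less t u) = (\<lambda>e. ob (val ab e t) < ob (val ab e u))"
| "sat U ab (Pred T ts) = (\<lambda>e. map ob (map (val ab e) ts) \<in> cn (val ab e T))"
| "sat U ab Fls = (\<lambda>e. False)"
| "sat U ab (Imp A B) = (\<lambda>e. sat U ab A e \<longrightarrow> sat U ab B e)"
| "sat U ab (Forall v A) = (\<lambda>e. \<forall>d\<in>sdom U (fst v). sat U ab A (e(v := d)))"

definition good :: "nat list set set \<Rightarrow> (var \<Rightarrow> tv) \<Rightarrow> bool" where
  "good U e \<longleftrightarrow> (\<forall>v. e v \<in> sdom U (fst v))"

lemma sat_connectives [simp]:
  "sat U ab (Neg A) e \<longleftrightarrow> \<not> sat U ab A e"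
  "sat U ab (Conj A B) e \<longleftrightarrow> sat U ab A e \<and> sat U ab B e"
  "sat U ab (Disj A B) e \<longleftrightarrow> sat U ab A e \<or> sat U ab B e"
  "sat U ab (Iff A B) e \<longleftrightarrow> (sat U ab A e \<longleftrightarrow> sat U ab B e)"
  "sat U ab (Exists v A) e \<longleftrightarrow> (\<exists>d\<in>sdom U (fst v). sat U ab A (e(v := d)))"
  by (auto simp: Neg_def Conj_def Disj_def Iff_def Exists_def)

lemma wff_connectives [simp]:
  "wff L (Neg A) \<longleftrightarrow> wff L A"
  "wff L (Exists v A) \<longleftrightarrow> valid_sort (fst v) \<and> wff L A"
  by (auto simp: Neg_def Exists_def)

lemma fv_Exists [simp]: "fv (Exists v A) = fv A - {v}"
  by (auto simp: Neg_def Exists_def)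

lemma good_upd: "good U e \<Longrightarrow> d \<in> sdom U (fst v) \<Longrightarrow> good U (e(v := d))"
  unfolding good_def by (metis fun_upd_apply)

lemma sdom_mono: "U \<subseteq> U' \<Longrightarrow> sdom U s \<subseteq> sdom U' s"
  by (cases s) auto

lemma good_mono: "good U e \<Longrightarrow> U \<subseteq> U' \<Longrightarrow> good U' e"
  using sdom_mono unfolding good_def by blast

lemma sec_sec: "sec (sec X as) bs = sec X (as @ bs)"
  by (simp add: sec_def)

lemma sec_Nil [simp]: "sec X [] = X"
  by (simp add: sec_def)

section \<open>Coincidence and substitution lemmas\<close>

lemma val_cong: "(\<And>v. v \<in> fvt t \<Longrightarrow> e v = e' v) \<Longrightarrow> val ab e t = val ab e' t"
proof (induction t)
  case (Section T ts)
  have "val ab e T = val ab e' T" by (rule Section.IH(1)) (simp add: Section.prems)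
  moreover have "map (val ab e) ts = map (val ab e') ts"
    by (rule map_cong[OF refl], rule Section.IH(2)) (use Section.prems in auto)
  ultimately show ?case by (simp del: map_map map_eq_conv)
qed simp_all

lemma sat_cong: "(\<And>v. v \<in> fv A \<Longrightarrow> e v = e' v) \<Longrightarrow> sat U ab A e = sat U ab A e'"
proof (induction A arbitrary: e e')
  case (Eq t u)
  then show ?case using val_cong[of t e e' ab] val_cong[of u e e' ab] by simp
next
  case (Less t u)
  then show ?case using val_cong[of t e e' ab] val_cong[of u e e' ab] by simp
next
  case (Pred T ts)
  have "val ab e T = val ab e' T" by (rule val_cong) (simp add: Pred.prems)
  moreover have "map (val ab e) ts = map (val ab e') ts"
    by (rule map_cong[OF refl], rule val_cong) (use Pred.prems in auto)
  ultimately show ?case by (simp del: map_map map_eq_conv)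
next
  case (Imp A B)
  have "sat U ab A e = sat U ab A e'" by (rule Imp.IH) (simp add: Imp.prems)
  moreover have "sat U ab B e = sat U ab B e'" by (rule Imp.IH) (simp add: Imp.prems)
  ultimately show ?case by simp
next
  case (Forall v A)
  have "sat U ab A (e(v := d)) = sat U ab A (e'(v := d))" for d
    by (rule Forall.IH) (simp add: Forall.prems)
  then show ?case by simp
qed simp

lemma val_substt: "val ab e (substt \<sigma> t) = val ab (\<lambda>v. val ab e (\<sigma> v)) t"
proof (induction t)
  case (Section T ts)
  have "map (val ab e) (map (substt \<sigma>) ts) = map (val ab (\<lambda>v. val ab e (\<sigma> v))) ts"
    using Section.IH(2) by simp
  then show ?case using Section.IH(1) by (simp del: map_map)
qed simp_all

lemma finite_fvt: "finite (fvt t)"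
  by (induction t) auto

lemma finite_fv: "finite (fv A)"
  by (induction A) (auto simp: finite_fvt)

lemma avoid_fresh:
  assumes "finite X"
  shows "avoid X v \<notin> X" "fst (avoid X v) = fst v"
proof -
  have "finite ((\<lambda>i. (fst v, i)) -` X)" by (rule finite_vimageI[OF assms]) (simp add: inj_on_def)
  then obtain i where "(fst v, i) \<notin> X" using ex_new_if_finite[OF infinite_UNIV_nat] by fastforce
  then have "(fst v, LEAST i. (fst v, i) \<notin> X) \<notin> X" by (rule LeastI)
  then show "avoid X v \<notin> X" by (simp add: avoid_def)
  show "fst (avoid X v) = fst v" by (simp add: avoid_def)
qed

lemma sat_subst: "sat U ab (subst A \<sigma>) e = sat U ab A (\<lambda>v. val ab e (\<sigma> v))"
proof (induction A arbitrary: \<sigma> e)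
  case (Pred T ts)
  have "map (val ab e) (map (substt \<sigma>) ts) = map (val ab (\<lambda>v. val ab e (\<sigma> v))) ts"
    by (simp add: val_substt)
  then show ?case by (simp add: val_substt del: map_map)
next
  case (Forall v A)
  \<comment> \<open>\<open>X\<close> collects the variables of the terms put in for free variables
    other than \<open>v\<close>; \<open>w\<close> avoids it, so assigning to \<open>w\<close> leaves
    the values of these terms unchanged.\<close>
  define X where "X = (\<Union>u \<in> fv A - {v}. fvt (\<sigma> u))"
  have "finite X" by (auto simp: X_def finite_fv finite_fvt)
  define w where "w = avoid X v"
  have w: "w \<notin> X" "fst w = fst v" using avoid_fresh[OF \<open>finite X\<close>] by (auto simp: w_def)
  have "sat U ab (subst A (\<sigma>(v := Var w))) (e(w := d)) = sat U ab A ((\<lambda>u. val ab e (\<sigma> u))(v := d))" for d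
  proof -
    have "sat U ab (subst A (\<sigma>(v := Var w))) (e(w := d))
        = sat U ab A (\<lambda>u. val ab (e(w := d)) ((\<sigma>(v := Var w)) u))" by (rule Forall.IH)
    also have "\<dots> = sat U ab A ((\<lambda>u. val ab e (\<sigma> u))(v := d))"
    proof (rule sat_cong)
      fix u assume u: "u \<in> fv A"
      show "val ab (e(w := d)) ((\<sigma>(v := Var w)) u) = ((\<lambda>u. val ab e (\<sigma> u))(v := d)) u"
      proof (cases "u = v")
        case False
        then have "w \<notin> fvt (\<sigma> u)" using w u by (auto simp: X_def)
        then have "val ab (e(w := d)) (\<sigma> u) = val ab e (\<sigma> u)" by (intro val_cong) auto
        then show ?thesis using False by simp
      qed simp
    qed
    finally show ?thesis .
  qed
  then show ?case using w by (simp add: Let_def X_def[symmetric] w_def[symmetric])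
qed (simp_all add: val_substt)

lemma sat_subst1: "sat U ab (subst1 A v t) e = sat U ab A (e(v := val ab e t))"
proof -
  have "(\<lambda>u. val ab e ((Var(v := t)) u)) = e(v := val ab e t)" by auto
  then show ?thesis by (simp add: subst1_def sat_subst)
qed

section \<open>Closure under sections and soundness of the calculus\<close>

definition sec_closed :: "nat list set set \<Rightarrow> bool" where
  "sec_closed U \<longleftrightarrow> (\<forall>X\<in>U. \<forall>as. sec X as \<in> U)"

lemma val_sort:
  assumes "has_sort L t s" "sec_closed U" "good U e"
  shows "val ab e t \<in> sdom U s"
  using assms(1)
proof induction
  case (Var s x)
  then show ?case using assms(3) by (auto simp: good_def dest: spec[of _ "(s, x)"])
next
  case (Section T k ts)
  then obtain X where X: "val ab e T = Cn X" "X \<in> U" "\<forall>l\<in>X. length l = k" by auto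
  have "sec X (map ob (map (val ab e) ts)) \<in> U" using X assms(2) by (simp add: sec_closed_def)
  moreover have "\<forall>l\<in>sec X (map ob (map (val ab e) ts)). length l = k - length ts"
    using X(3) by (auto simp: sec_def)
  ultimately show ?case using X by simp
qed simp

text \<open>Generalization reads free variables universally, so the assignment varies through the
  induction and the axioms must hold at every good assignment.\<close>

theorem soundness:
  assumes "proves L \<Gamma> A" "sec_closed U"
    and ax: "\<And>A e. A \<in> \<Gamma> \<Longrightarrow> good U e \<Longrightarrow> sat U ab A e"
    and "good U e"
  shows "sat U ab A e"
  using assms(1,4)
proof (induction arbitrary: e)
  case (Inst v A t)
  then show ?case using val_sort[OF _ assms(2)] by (simp add: sat_subst1)
next
  case (Distr v A B)
  have "sat U ab A (e(v := d)) = sat U ab A e" for d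
    using Distr by (intro sat_cong) auto
  then show ?case by simp
next
  case (Leibniz A t v u)
  then show ?case by (simp add: sat_subst1)
next
  case (MP A B)
  then show ?case by simp
next
  case (Gen A v)
  then show ?case by (auto intro!: Gen.IH good_upd)
qed (auto intro: ax)

section \<open>Assignments to a block of object variables\<close>

fun oupd :: "(var \<Rightarrow> tv) \<Rightarrow> nat list \<Rightarrow> nat list \<Rightarrow> var \<Rightarrow> tv" where
  "oupd e (x # xs) (a # as) = oupd (e(ovar x := Ob a)) xs as"
| "oupd e _ _ = e"

lemma oupd_notin: "v \<notin> ovar ` set xs \<Longrightarrow> oupd e xs as v = e v"
  by (induction e xs as rule: oupd.induct) auto

lemma good_oupd: "good U e \<Longrightarrow> good U (oupd e xs as)"
  by (induction e xs as rule: oupd.induct) (auto simp: good_upd)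

lemma oupd_agree: "(\<forall>v\<in>V. e v = e' v) \<Longrightarrow> v \<in> V \<Longrightarrow> oupd e xs as v = oupd e' xs as v"
proof (induction xs as arbitrary: e e' rule: list_induct2')
  case (4 x xs a as)
  have "\<forall>v\<in>V. (e(ovar x := Ob a)) v = (e'(ovar x := Ob a)) v" using 4(2) by simp
  then show ?case unfolding oupd.simps using 4(1,3) by blast
qed simp_all

lemma oupd_upd: "v \<notin> ovar ` set xs \<Longrightarrow> oupd (e(v := d)) xs as = (oupd e xs as)(v := d)"
proof (induction xs as arbitrary: e rule: list_induct2')
  case (4 x xs a as)
  then have "v \<noteq> ovar x" by auto
  then have tw: "e(v := d, ovar x := Ob a) = e(ovar x := Ob a, v := d)" by (rule fun_upd_twist)
  have "v \<notin> ovar ` set xs" using 4(2) by auto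
  then show ?case unfolding oupd.simps tw by (rule 4(1))
qed simp_all

lemma oupd_oterms:
  assumes "distinct xs" "length xs = length as"
  shows "map ob (map (val ab (oupd e xs as)) (oterms xs)) = as"
  using assms
proof (induction xs as arbitrary: e rule: list_induct2')
  case (4 x xs a as)
  have "oupd (e(ovar x := Ob a)) xs as (ovar x) = Ob a" using 4 by (subst oupd_notin) auto
  then show ?case using 4 by (simp del: map_map)
qed simp_all

lemma sat_Foralls_ovars:
  "sat U ab (Foralls (ovars xs) A) e \<longleftrightarrow> (\<forall>as. length as = length xs \<longrightarrow> sat U ab A (oupd e xs as))"
proof (induction xs arbitrary: e)
  case (Cons x xs)
  have "sat U ab (Foralls (ovars (x # xs)) A) e
      \<longleftrightarrow> (\<forall>a as. length as = length xs \<longrightarrow> sat U ab A (oupd (e(ovar x := Ob a)) xs as))"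
  proof -
    have "sat U ab (Foralls (ovars (x # xs)) A) e
        \<longleftrightarrow> (\<forall>a. sat U ab (Foralls (ovars xs) A) (e(ovar x := Ob a)))"
      by (simp add: Foralls_def)
    then show ?thesis unfolding Cons.IH by blast
  qed
  also have "\<dots> \<longleftrightarrow> (\<forall>as. length as = length (x # xs) \<longrightarrow> sat U ab A (oupd e (x # xs) as))"
    unfolding length_Suc_conv length_Cons by (metis length_Suc_conv oupd.simps(1))
  finally show ?case .
qed (simp add: Foralls_def)

section \<open>Soundness of the axioms of SO and GC\<close>

text \<open>The extension of \<open>A\<close> under \<open>e\<close> is the witness;
  \<open>R\<close> is not free in \<open>A\<close>, so assigning this set to \<open>R\<close> does
  not change the truth of \<open>A\<close>.\<close>

lemma sat_comprehension:
  assumes "distinct xs" "cvar (length xs) R \<notin> fv A"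
    and "{as. length as = length xs \<and> sat U ab A (oupd e xs as)} \<in> U"
  shows "sat U ab (comprehension_instance R xs A) e"
proof -
  let ?X = "{as. length as = length xs \<and> sat U ab A (oupd e xs as)}"
  let ?e = "e(cvar (length xs) R := Cn ?X)"
  have u: "oupd ?e xs as = (oupd e xs as)(cvar (length xs) R := Cn ?X)" for as
    by (rule oupd_upd) auto
  have "sat U ab (Iff (Pred (Var (cvar (length xs) R)) (oterms xs)) A) (oupd ?e xs as)"
    if "length as = length xs" for as
  proof -
    have "sat U ab A (oupd ?e xs as) = sat U ab A (oupd e xs as)"
      using assms(2) by (intro sat_cong) (auto simp: u)
    moreover have "map ob (map (val ab (oupd ?e xs as)) (oterms xs)) = as"
      using assms(1) that by (intro oupd_oterms) auto
    moreover have "val ab (oupd ?e xs as) (Var (cvar (length xs) R)) = Cn ?X"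
      by (simp add: u)
    ultimately show ?thesis using that by (simp del: map_map)
  qed
  moreover have "Cn ?X \<in> sdom U (fst (cvar (length xs) R))" using assms(3) by auto
  ultimately show ?thesis
    unfolding comprehension_instance_def Let_def sat_connectives sat_Foralls_ovars by blast
qed

lemma sat_extensionality: "sat U ab (extensionality k) e"
proof -
  have "X = Y" if XY: "X \<in> U" "\<forall>l\<in>X. length l = k" "Y \<in> U" "\<forall>l\<in>Y. length l = k"
    and *: "sat U ab (Foralls (ovars [0..<k])
               (Iff (Pred (Var (cvar k 0)) (oterms [0..<k]))
                    (Pred (Var (cvar k 1)) (oterms [0..<k])))) (e(cvar k 0 := Cn X, cvar k 1 := Cn Y))"
    for X Y
  proof -
    let ?e = "e(cvar k 0 := Cn X, cvar k 1 := Cn Y)"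
    have "as \<in> X \<longleftrightarrow> as \<in> Y" if "length as = k" for as
    proof -
      have "map ob (map (val ab (oupd ?e [0..<k] as)) (oterms [0..<k])) = as"
        using that by (intro oupd_oterms) auto
      moreover have "oupd ?e [0..<k] as (cvar k 0) = Cn X" "oupd ?e [0..<k] as (cvar k 1) = Cn Y"
        by (subst oupd_notin; auto)+
      moreover have "sat U ab (Iff (Pred (Var (cvar k 0)) (oterms [0..<k]))
                    (Pred (Var (cvar k 1)) (oterms [0..<k]))) (oupd ?e [0..<k] as)"
        using * that unfolding sat_Foralls_ovars by simp
      ultimately show ?thesis by (simp del: map_map)
    qed
    then show ?thesis using XY by blast
  qed
  then show ?thesis by (auto simp: extensionality_def Foralls_def[of "[_, _]"] simp del: sat_connectives)
qed

lemma sat_section_axiom: "sat U ab (section_axiom n m) e"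
proof -
  have "sat U ab (Foralls (ovars [0..<n + m])
       (Iff (Pred (Section (Var (cvar (n + m) 0)) (oterms [0..<n])) (oterms [n..<n + m]))
            (Pred (Var (cvar (n + m) 0)) (oterms [0..<n + m])))) (e(cvar (n + m) 0 := Cn X))" for X
    unfolding sat_Foralls_ovars
  proof (intro allI impI)
    fix as :: "nat list" assume l: "length as = length [0..<n + m]"
    let ?e = "oupd (e(cvar (n + m) 0 := Cn X)) [0..<n + m] as"
    have as: "map ob (map (val ab ?e) (oterms [0..<n + m])) = as"
      using l by (intro oupd_oterms) auto
    have "[0..<n + m] = [0..<n] @ [n..<n + m]" by (rule upt_add_eq_append) simp
    then have split: "map f [0..<n] @ map f [n..<n + m] = map f [0..<n + m]" for f :: "nat \<Rightarrow> nat"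
      by (metis map_append)
    have "map ob (map (val ab ?e) (oterms [0..<n])) @ map ob (map (val ab ?e) (oterms [n..<n + m])) = as"
      using as unfolding map_map split .
    moreover have "?e (cvar (n + m) 0) = Cn X" by (subst oupd_notin) auto
    ultimately show "sat U ab (Iff (Pred (Section (Var (cvar (n + m) 0)) (oterms [0..<n])) (oterms [n..<n + m]))
            (Pred (Var (cvar (n + m) 0)) (oterms [0..<n + m]))) ?e"
      using as unfolding sat_connectives sat.simps val.simps tv.sel sec_def mem_Collect_eq by argo
  qed
  then show ?thesis unfolding section_axiom_def sat.simps by auto
qed

text \<open>Extensionality and the section axioms hold over any universe because concepts are sets
  of lists; only comprehension asks for the closure in the third assumption.\<close>

lemma sat_SO:
  assumes "A \<in> SO L" "good U e"
    and "\<And>xs A e. wff L A \<Longrightarrow> good U e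
      \<Longrightarrow> {as. length as = length xs \<and> sat U ab A (oupd e xs as)} \<in> U"
  shows "sat U ab A e"
proof -
  consider k where "A = extensionality k" | n m where "A = section_axiom n m"
    | R xs B where "A = comprehension_instance R xs B" "distinct xs" "wff L B"
      "cvar (length xs) R \<notin> fv B"
    using assms(1) unfolding SO_def full_comprehension_def by blast
  then show ?thesis
  proof cases
    case (3 R xs B)
    show ?thesis unfolding 3(1) by (rule sat_comprehension[OF 3(2,4) assms(3)[OF 3(3) assms(2)]])
  qed (use sat_extensionality sat_section_axiom in blast)+
qed

text \<open>Objects are all the natural numbers whatever \<open>U\<close> and \<open>ab\<close> are,
  so well-foundedness gives a least instance even for formulas with \<open>\<partial>\<close> and
  concept quantifiers.\<close>

lemma sat_least_instance:
  assumes "x \<noteq> y" "ovar y \<notin> fv A"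
  shows "sat U ab (least_instance (ovar x) (ovar y) A) e"
proof -
  have y: "sat U ab A (e(ovar y := Ob b, ovar x := Ob b)) = sat U ab A (e(ovar x := Ob b))"
    for b using assms by (intro sat_cong) auto
  have "\<exists>a. sat U ab A (e(ovar x := Ob a)) \<and> (\<forall>b<a. \<not> sat U ab A (e(ovar x := Ob b)))"
    if "sat U ab A (e(ovar x := Ob a))" for a
    using that exists_least_iff[of "\<lambda>a. sat U ab A (e(ovar x := Ob a))"] by auto
  then show ?thesis using assms
    by (auto simp: least_instance_def sat_subst1 y fun_upd_twist[of "ovar x" "ovar y"])
qed

lemma sat_strict_linear_order: "A \<in> strict_linear_order_axioms \<Longrightarrow> sat U ab A e"
  by (auto simp: strict_linear_order_axioms_def Let_def Foralls_def)

lemma sat_GC: "A \<in> GC L \<Longrightarrow> sat U ab A e"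
  unfolding GC_def using sat_strict_linear_order sat_least_instance by blast

section \<open>Absoluteness\<close>

lemma val_agree:
  assumes "has_sort L t s" "sec_closed U" "good U e" "\<forall>X\<in>U. ab X = ab' X"
  shows "val ab e t = val ab' e t"
  using assms(1)
proof induction
  case (Section T k ts)
  have "map (val ab e) ts = map (val ab' e) ts" using Section by simp
  then show ?case using Section by (simp del: map_map map_eq_conv)
next
  case (Abstr n T)
  have "val ab e T \<in> sdom U (Con n)" using val_sort[OF Abstr(2) assms(2,3)] .
  then show ?case using Abstr assms(4) by auto
qed simp

lemma val_agree_list:
  assumes "\<forall>t\<in>set ts. has_sort L t s" "sec_closed U" "good U e" "\<forall>X\<in>U. ab X = ab' X"
  shows "map (val ab e) ts = map (val ab' e) ts"
  using val_agree[OF _ assms(2-4)] assms(1) unfolding map_eq_conv by blast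

text \<open>Object quantifiers range over all numbers in both structures, and terms evaluate
  \<open>ab\<close> only at members of \<open>U\<close>. This allows comparing structures neither of
  whose universes contains the other.\<close>

lemma first_order_absolute:
  assumes "first_order A" "wff L A" "good U e" "sec_closed U" "\<forall>X\<in>U. ab X = ab' X"
  shows "sat U ab A e \<longleftrightarrow> sat U' ab' A e"
  using assms(1-3)
proof (induction A arbitrary: e)
  case (Eq t u)
  then have "val ab e t = val ab' e t" "val ab e u = val ab' e u"
    using val_agree[OF _ assms(4) _ assms(5)] by auto
  then show ?case by simp
next
  case (Less t u)
  then have "val ab e t = val ab' e t" "val ab e u = val ab' e u"
    using val_agree[OF _ assms(4) _ assms(5)] by auto
  then show ?case by simp
next
  case (Pred T ts)
  have "val ab e T = val ab' e T" using Pred val_agree[OF _ assms(4) _ assms(5)] by auto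
  moreover have "map (val ab e) ts = map (val ab' e) ts"
    using Pred by (intro val_agree_list[OF _ assms(4) _ assms(5)]) auto
  ultimately show ?case by (simp del: map_map map_eq_conv)
next
  case (Forall v A)
  have s: "sdom U (fst v) = sdom U' (fst v)" using Forall.prems by simp
  have "sat U ab A (e(v := d)) \<longleftrightarrow> sat U' ab' A (e(v := d))" if "d \<in> sdom U (fst v)" for d
    using Forall good_upd[OF _ that] by simp
  then show ?case using s by simp
qed simp_all

text \<open>Concept witnesses in \<open>U\<close> are still present in \<open>U'\<close>, which
  reduces the claim to absoluteness of the first-order kernel.\<close>

lemma sigma11_upward:
  assumes "sigma11 A" "wff L A" "good U e"
    and "sec_closed U" "U \<subseteq> U'" "\<forall>X\<in>U. ab X = ab' X"
    and "sat U ab A e"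
  shows "sat U' ab' A e"
  using assms(1-3,7)
proof (induction arbitrary: e)
  case (1 A)
  then show ?case using first_order_absolute[OF _ _ _ assms(4,6)] by blast
next
  case (2 A k R)
  then obtain d where d: "d \<in> sdom U (Con k)" "sat U ab A (e(cvar k R := d))" by auto
  then have "sat U' ab' A (e(cvar k R := d))" using 2 good_upd[of U e d "cvar k R"] by auto
  then show ?case using d sdom_mono[OF assms(5), of "Con k"] by auto
qed

lemma sat_abstr_free:
  assumes "wff L A" "abstr_arity L = None"
  shows "sat U ab A e \<longleftrightarrow> sat U ab' A e"
proof -
  have t: "val ab e t = val ab' e t" if "has_sort L t s" for t s e
    using that
  proof induction
    case (Section T k ts)
    have "map (val ab e) ts = map (val ab' e) ts" using Section by simp
    then show ?case using Section by (simp del: map_map map_eq_conv)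
  qed (use assms in simp_all)
  show ?thesis
    using assms(1)
  proof (induction A arbitrary: e)
    case (Pred T ts)
    have "val ab e T = val ab' e T" using Pred t by auto
    moreover have "map (val ab e) ts = map (val ab' e) ts" using Pred t by auto
    ultimately show ?case by (simp del: map_map map_eq_conv)
  next
    case (Eq t u)
    then have "val ab e t = val ab' e t" "val ab e u = val ab' e u" using t by auto
    then show ?case by simp
  next
    case (Less t u)
    then have "val ab e t = val ab' e t" "val ab e u = val ab' e u" using t by auto
    then show ?case by simp
  qed simp_all
qed

section \<open>Forcing conditions for the abstraction operator\<close>

type_synonym cnd = "(nat list set \<rightharpoonup> nat) \<times> nat set"

definition extends :: "cnd \<Rightarrow> cnd \<Rightarrow> bool" where
  "extends q p \<longleftrightarrow> fst p \<subseteq>\<^sub>m fst q \<and> ran (fst q) \<subseteq> ran (fst p) \<union> snd p \<and> snd q \<subseteq> snd p"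

lemma extends_refl [simp]: "extends p p"
  by (auto simp: extends_def)

lemma extends_trans: "extends r q \<Longrightarrow> extends q p \<Longrightarrow> extends r p"
  unfolding extends_def by (auto intro: map_le_trans)

text \<open>The sections of a concept include the concept itself, taken at the empty list.\<close>

definition Cov :: "(nat list set \<rightharpoonup> nat) \<Rightarrow> nat list set set" where
  "Cov p = {X. \<forall>as. sec X as \<in> dom p}"

lemma sec_closed_Cov: "sec_closed (Cov p)"
  by (simp add: sec_closed_def Cov_def sec_sec)

lemma Cov_dom: "X \<in> Cov p \<Longrightarrow> X \<in> dom p"
  unfolding Cov_def using sec_Nil by (metis mem_Collect_eq)

lemma Cov_mono: "p \<subseteq>\<^sub>m q \<Longrightarrow> Cov p \<subseteq> Cov q"
  unfolding Cov_def using map_le_implies_dom_le by blast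

section \<open>Values of partial maps and limits of chains\<close>

definition vals :: "('a \<rightharpoonup> nat) \<Rightarrow> 'a \<Rightarrow> nat" where
  "vals p x = the (p x)"

lemma map_le_vals: "p \<subseteq>\<^sub>m q \<Longrightarrow> \<forall>X\<in>Cov p. vals p X = vals q X"
  using Cov_dom by (fastforce simp: map_le_def vals_def)

text \<open>For an increasing chain this is the union of the maps; picking the least stage makes it
  a function for any sequence.\<close>

definition limit :: "(nat \<Rightarrow> ('a \<rightharpoonup> 'b)) \<Rightarrow> ('a \<rightharpoonup> 'b)" where
  "limit q x = (if \<exists>k. x \<in> dom (q k) then q (LEAST k. x \<in> dom (q k)) x else None)"

lemma chain_map_le:
  assumes "\<And>k. q k \<subseteq>\<^sub>m q (Suc k)" "i \<le> j"
  shows "q i \<subseteq>\<^sub>m q j"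
  using assms(2) by (induction rule: dec_induct) (auto intro: map_le_trans assms(1))

lemma limit_upper:
  assumes "\<And>k. q k \<subseteq>\<^sub>m q (Suc k)"
  shows "q k \<subseteq>\<^sub>m limit q"
  unfolding map_le_def
proof
  fix x assume x: "x \<in> dom (q k)"
  let ?l = "LEAST k. x \<in> dom (q k)"
  have "x \<in> dom (q ?l)" "?l \<le> k" using x by (rule LeastI, rule Least_le)
  then have "q ?l x = q k x" using chain_map_le[of q, OF assms] by (auto simp: map_le_def)
  then show "q k x = limit q x" using x by (auto simp: limit_def)
qed

lemma limit_SomeD: "limit q x = Some y \<Longrightarrow> \<exists>k. q k x = Some y"
  by (auto simp: limit_def split: if_splits)

lemma ran_limit: "ran (limit q) \<subseteq> (\<Union>k. ran (q k))"
  using limit_SomeD by (fastforce simp: ran_def)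

section \<open>Conditions compatible with an equivalence relation\<close>

locale equivalence =
  fixes EE :: "nat list set \<Rightarrow> nat list set \<Rightarrow> bool"
  assumes equivp: "equivp EE"
begin

definition faithful :: "(nat list set \<rightharpoonup> nat) \<Rightarrow> bool" where
  "faithful p \<longleftrightarrow> (\<forall>X Y i j. p X = Some i \<longrightarrow> p Y = Some j \<longrightarrow> (i = j \<longleftrightarrow> EE X Y))"

text \<open>The infinite set of a condition reserves the values that are still free.\<close>

definition cond :: "cnd \<Rightarrow> bool" where
  "cond p \<longleftrightarrow> infinite (snd p) \<and> ran (fst p) \<inter> snd p = {} \<and> faithful (fst p)"

text \<open>Any two values of the limit already occur together at a common stage.\<close>

lemma faithful_limit:
  assumes "\<And>k. q k \<subseteq>\<^sub>m q (Suc k)" "\<And>k. faithful (q k)"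
  shows "faithful (limit q)"
  unfolding faithful_def
proof (intro allI impI)
  fix X Y i j assume "limit q X = Some i" "limit q Y = Some j"
  then obtain k l where kl: "q k X = Some i" "q l Y = Some j" by (meson limit_SomeD)
  have "q (max k l) X = Some i" "q (max k l) Y = Some j"
    using chain_map_le[of q, OF assms(1), of k "max k l"] chain_map_le[of q, OF assms(1), of l "max k l"] kl
    by (auto simp: map_le_def dom_def)
  then show "i = j \<longleftrightarrow> EE X Y" using assms(2) unfolding faithful_def by blast
qed

text \<open>Old equivalence classes keep their values and new ones receive reserved values. Only
  every second reserved value is offered, so infinitely many remain.\<close>

lemma cover_countable:
  fixes c :: "nat \<Rightarrow> nat list set"
  assumes "cond p"
  shows "\<exists>q. cond q \<and> extends q p \<and> range c \<subseteq> dom (fst q)"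
proof -
  define P G where "P = fst p" "G = snd p"
  have inf: "infinite G" and disj: "ran P \<inter> G = {}" and resp: "faithful P"
    using assms by (auto simp: cond_def P_G_def)
  define g where "g = enumerate G"
  have gG: "g i \<in> G" for i using enumerate_in_set[OF inf] by (simp add: g_def)
  have ginj: "g i = g j \<longleftrightarrow> i = j" for i j
    using strict_mono_enumerate[OF inf] by (simp add: g_def strict_mono_eq)
  \<comment> \<open>A class met by \<open>dom P\<close> keeps its value; any other class met by
    \<open>c\<close> gets the value indexed by its first representative in \<open>c\<close>. Both
    choices depend on the class alone.\<close>
  define old where "old Y \<longleftrightarrow> (\<exists>Z\<in>dom P. EE Z Y)" for Y
  define idx where "idx Y = (LEAST j. EE (c j) Y)" for Y
  define v where "v Y = (if old Y then the (P (SOME Z. Z \<in> dom P \<and> EE Z Y)) else g (2 * idx Y))" for Y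
  define q where "q = (\<lambda>Y. if Y \<in> dom P \<union> range c then Some (v Y) else None)"
  have refl: "EE X X" for X using equivp by (simp add: equivp_reflp)
  have sym: "EE X Y \<Longrightarrow> EE Y X" for X Y using equivp by (simp add: equivp_symp)
  have trans: "EE X Y \<Longrightarrow> EE Y Z \<Longrightarrow> EE X Z" for X Y Z using equivp by (blast intro: equivp_transp)
  have v_old: "\<exists>Z. EE Z Y \<and> P Z = Some (v Y)" if "old Y" for Y
  proof -
    have "\<exists>Z. Z \<in> dom P \<and> EE Z Y" using that by (auto simp: old_def)
    from someI_ex[OF this] show ?thesis using that by (auto simp: v_def)
  qed
  have v_new: "v Y = g (2 * idx Y)" if "\<not> old Y" for Y using that by (simp add: v_def)
  have idx: "EE (c (idx Y)) Y" if "Y \<in> range c" for Y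
  proof -
    have "\<exists>j. EE (c j) Y" using that refl by auto
    then show ?thesis unfolding idx_def by (rule LeastI_ex)
  qed
  have idx_cong: "idx Y = idx Y'" if "EE Y Y'" for Y Y'
    unfolding idx_def using that sym trans by metis
  have old_cong: "old Y \<longleftrightarrow> old Y'" if "EE Y Y'" for Y Y'
    unfolding old_def using that sym trans by metis
  have old_dom: "old Y" if "Y \<in> dom P" for Y using that refl by (auto simp: old_def)
  have vP: "P Y = Some (v Y)" if Y: "Y \<in> dom P" for Y
  proof -
    obtain Z where "EE Z Y" "P Z = Some (v Y)" using v_old[OF old_dom[OF Y]] by blast
    moreover obtain i where "P Y = Some i" using Y by auto
    ultimately show ?thesis using resp sym by (auto simp: faithful_def)
  qed
  have P_ran: "i \<notin> G" if "P Z = Some i" for Z i using that disj by (auto simp: ran_def)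
  have eq: "v Y = v Y' \<longleftrightarrow> EE Y Y'" if Y: "Y \<in> dom P \<union> range c" "Y' \<in> dom P \<union> range c" for Y Y'
  proof -
    consider "old Y" "old Y'" | "\<not> old Y" "\<not> old Y'" | "old Y \<longleftrightarrow> \<not> old Y'" by blast
    then show ?thesis
    proof cases
      case 1
      then obtain Z Z' where Z: "EE Z Y" "P Z = Some (v Y)" "EE Z' Y'" "P Z' = Some (v Y')"
        using v_old by meson
      then have "v Y = v Y' \<longleftrightarrow> EE Z Z'" using resp by (auto simp: faithful_def)
      then show ?thesis using Z sym trans by meson
    next
      case 2
      then have "Y \<in> range c" "Y' \<in> range c" using Y old_dom by auto
      then have "EE (c (idx Y)) Y" "EE (c (idx Y')) Y'" using idx by auto
      moreover have "v Y = v Y' \<longleftrightarrow> idx Y = idx Y'" using 2 v_new ginj by simp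
      ultimately show ?thesis using idx_cong sym trans by metis
    next
      case 3
      have "v Y \<noteq> v Y'" using 3 v_old v_new gG P_ran by metis
      then show ?thesis using 3 old_cong by blast
    qed
  qed
  have le: "P \<subseteq>\<^sub>m q" using vP by (auto simp: map_le_def q_def)
  have ran: "ran q \<subseteq> ran P \<union> range (\<lambda>i. g (2 * i))"
  proof
    fix i assume "i \<in> ran q"
    then obtain Y where "i = v Y" by (auto simp: q_def ran_def split: if_splits)
    then show "i \<in> ran P \<union> range (\<lambda>i. g (2 * i))"
      using v_old[of Y] v_new[of Y] by (cases "old Y") (auto intro: ranI)
  qed
  \<comment> \<open>The odd-indexed values form the new reserve; \<open>v\<close> gives new classes
    only even-indexed ones.\<close>
  let ?H = "range (\<lambda>i. g (2 * i + 1))"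
  have "2 * a \<noteq> 2 * b + 1" for a b :: nat by presburger
  then have "range (\<lambda>i. g (2 * i)) \<inter> ?H = {}" by (auto simp: ginj)
  moreover have "?H \<subseteq> G" using gG by auto
  moreover have "infinite ?H" by (rule range_inj_infinite) (auto simp: inj_def ginj)
  moreover have "faithful q" using eq by (auto simp: faithful_def q_def split: if_splits)
  ultimately have "cond (q, ?H)" using ran disj unfolding cond_def fst_conv snd_conv by blast
  moreover have "extends (q, ?H) p"
    unfolding extends_def fst_conv snd_conv P_G_def[symmetric] using le ran gG by auto
  moreover have "range c \<subseteq> dom q" by (auto simp: q_def)
  ultimately show ?thesis by (intro exI[of _ "(q, ?H)"]) simp
qed

text \<open>There are countably many lists of numbers, hence countably many sections of
  \<open>X\<close>, and one countable extension adds them all.\<close>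

lemma cover:
  assumes "cond p"
  shows "\<exists>q. cond q \<and> extends q p \<and> X \<in> Cov (fst q)"
proof -
  obtain q where q: "cond q" "extends q p" "range (\<lambda>i. sec X (from_nat i)) \<subseteq> dom (fst q)"
    using cover_countable[OF assms] by meson
  have "sec X as \<in> dom (fst q)" for as using q(3) from_nat_to_nat[of as] by (metis range_subsetD)
  then have "X \<in> Cov (fst q)" by (simp add: Cov_def)
  then show ?thesis using q by blast
qed

text \<open>A fusion argument: deciding the countably many instances in turn, one further free value is
  set aside at each stage, and the values set aside form the infinite set of the limit condition.\<close>

lemma decide:
  fixes T :: "(nat list set \<rightharpoonup> nat) \<Rightarrow> nat list \<Rightarrow> bool"
  assumes "cond p" and mono: "\<And>p q i. p \<subseteq>\<^sub>m q \<Longrightarrow> T p i \<Longrightarrow> T q i"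
  shows "(\<exists>q. cond q \<and> extends q p \<and> (\<exists>i. \<forall>r. cond r \<longrightarrow> extends r q \<longrightarrow> \<not> T (fst r) i))
       \<or> (\<exists>q. cond q \<and> extends q p \<and> (\<forall>i. T (fst q) i))"
proof (rule disjCI)
  assume "\<not> (\<exists>q. cond q \<and> extends q p \<and> (\<forall>i. T (fst q) i))"
  show "\<exists>q. cond q \<and> extends q p \<and> (\<exists>i. \<forall>r. cond r \<longrightarrow> extends r q \<longrightarrow> \<not> T (fst r) i)"
  proof (rule ccontr)
    assume "\<not> ?thesis"
    \<comment> \<open>Both alternatives are supposed to fail. Failure of the first means that below
      \<open>p\<close> every condition extends to one making a given instance true.\<close>
    then have ex: "\<exists>r. cond r \<and> extends r q \<and> T (fst r) i" if "cond q" "extends q p" for q i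
      using that by blast
    \<comment> \<open>At stage \<open>n\<close> a value \<open>h\<close> is struck from the reserve
      before the next condition is chosen, and that condition makes the instance coded by
      \<open>n\<close> true.\<close>
    have "\<exists>y. (cond y \<and> extends y p) \<and>
        (\<exists>h\<in>snd x. extends y (fst x, snd x - {h}) \<and> T (fst y) (from_nat n))"
      if x: "cond x \<and> extends x p" for x and n :: nat
    proof -
      have "infinite (snd x)" using x by (simp add: cond_def)
      then obtain h where h: "h \<in> snd x" by (metis finite.emptyI equals0I)
      have "cond (fst x, snd x - {h})" using x by (auto simp: cond_def)
      moreover have le: "extends (fst x, snd x - {h}) x" by (auto simp: extends_def)
      ultimately obtain y where "cond y" "extends y (fst x, snd x - {h})" "T (fst y) (from_nat n)"
        using ex extends_trans x by blast
      then show ?thesis using h extends_trans le x by blast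
    qed
    then obtain c where c: "\<And>n. cond (c n)" "\<And>n. extends (c n) p"
      "\<And>n. \<exists>h\<in>snd (c n). extends (c (Suc n)) (fst (c n), snd (c n) - {h}) \<and> T (fst (c (Suc n))) (from_nat n)"
      using dependent_nat_choice[of "\<lambda>n x. cond x \<and> extends x p"
          "\<lambda>n x y. \<exists>h\<in>snd x. extends y (fst x, snd x - {h}) \<and> T (fst y) (from_nat n)"] assms(1)
        extends_refl by metis
    then obtain h where h: "\<And>n. h n \<in> snd (c n)"
      "\<And>n. extends (c (Suc n)) (fst (c n), snd (c n) - {h n})" "\<And>n. T (fst (c (Suc n))) (from_nat n)"
      by metis
    have ch: "fst (c n) \<subseteq>\<^sub>m fst (c (Suc n))" "ran (fst (c (Suc n))) \<subseteq> ran (fst (c n)) \<union> (snd (c n) - {h n})"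
      "snd (c (Suc n)) \<subseteq> snd (c n) - {h n}" for n
      using h(2)[of n] by (auto simp: extends_def)
    have anti: "snd (c n) \<subseteq> snd (c m)" if "m \<le> n" for m n
      using that by (induction rule: dec_induct) (use ch(3) in blast)+
    have h_out: "h m \<notin> snd (c n)" if "m < n" for m n
      using anti[of "Suc m" n] ch(3)[of m] that by auto
    have "h m \<noteq> h n" if "m < n" for m n using h_out[OF that] h(1)[of n] by metis
    then have "inj h" by (metis injI nat_neq_iff)
    then have inf: "infinite (range h)" by (rule range_inj_infinite)
    \<comment> \<open>\<open>h n\<close> is in the reserve at stage \<open>n\<close>, hence at all
      earlier stages, and a reserve is disjoint from the range.\<close>
    have below: "h n \<notin> ran (fst (c m))" if "m \<le> n" for m n
      using anti[OF that] h(1)[of n] c(1)[of m] by (auto simp: cond_def)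
    \<comment> \<open>After stage \<open>n\<close>, new values come from reserves that lack
      \<open>h n\<close>.\<close>
    have "h n \<notin> ran (fst (c m))" if "n \<le> m" for m n
      using that
    proof (induction rule: dec_induct)
      case base
      then show ?case using below by simp
    next
      case (step m)
      then show ?case using ch(2)[of m] h_out[of n m] by (cases "n = m") auto
    qed
    then have disj: "h n \<notin> ran (fst (c m))" for m n using below by (metis nat_le_linear)
    let ?q = "limit (\<lambda>n. fst (c n))"
    have up: "fst (c n) \<subseteq>\<^sub>m ?q" for n
      using limit_upper[of "\<lambda>n. fst (c n)", OF ch(1)] .
    have "ran ?q \<inter> range h = {}" using disj ran_limit[of "\<lambda>n. fst (c n)"] by blast
    moreover have "faithful ?q"
      by (rule faithful_limit) (use ch(1) c(1) in \<open>auto simp: cond_def\<close>)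
    ultimately have "cond (?q, range h)" using inf by (simp add: cond_def)
    moreover have "extends (?q, range h) p"
    proof -
      have "fst p \<subseteq>\<^sub>m ?q" using c(2)[of 0] up[of 0] map_le_trans by (auto simp: extends_def)
      moreover have "ran ?q \<subseteq> ran (fst p) \<union> snd p"
        using ran_limit[of "\<lambda>n. fst (c n)"] c(2) by (fastforce simp: extends_def)
      moreover have "range h \<subseteq> snd p" using h(1) c(2) by (fastforce simp: extends_def)
      ultimately show ?thesis by (simp add: extends_def)
    qed
    moreover have "T ?q i" for i using mono[OF up h(3)[of "to_nat i"]] by simp
    ultimately show False using \<open>\<not> (\<exists>q. cond q \<and> extends q p \<and> (\<forall>i. T (fst q) i))\<close> by auto
  qed
qed

end

section \<open>Generic models\<close>

instance sort :: countable by countable_datatype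
instance trm :: countable by countable_datatype
instance fm :: countable by countable_datatype

lemma countable_closure:
  fixes F :: "'i::countable \<Rightarrow> 'a \<Rightarrow> 'a \<Rightarrow> 'a"
  assumes "countable B"
  shows "\<exists>M. countable M \<and> B \<subseteq> M \<and> (\<forall>i. \<forall>x\<in>M. \<forall>y\<in>M. F i x y \<in> M)"
proof -
  define f where "f = rec_nat B (\<lambda>_ X. X \<union> (\<lambda>(i, x, y). F i x y) ` (UNIV \<times> X \<times> X))"
  have f0: "f 0 = B" by (simp add: f_def)
  have fS: "f (Suc k) = f k \<union> (\<lambda>(i, x, y). F i x y) ` (UNIV \<times> f k \<times> f k)" for k
    by (simp add: f_def)
  have "countable (f k)" for k
  proof (induction k)
    case (Suc k)
    have "countable ((UNIV :: 'i set) \<times> f k \<times> f k)" by (intro countable_SIGMA countableI_type Suc)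
    then show ?case unfolding fS by (intro countable_Un countable_image Suc)
  qed (simp add: f0 assms)
  then have "countable (\<Union>k. f k)" by (intro countable_UN) simp_all
  moreover have "F i x y \<in> (\<Union>k. f k)" if xy: "x \<in> (\<Union>k. f k)" "y \<in> (\<Union>k. f k)" for i x y
  proof -
    obtain k l where kl: "x \<in> f k" "y \<in> f l" using xy by auto
    have mono: "f a \<subseteq> f b" if "a \<le> b" for a b by (rule lift_Suc_mono_le[OF _ that]) (subst fS, rule Un_upper1)
    have "x \<in> f (max k l)" "y \<in> f (max k l)" using kl mono[of k "max k l"] mono[of l "max k l"] by auto
    then have "F i x y \<in> f (Suc (max k l))"
      unfolding fS by (intro UnI2 image_eqI[of _ _ "(i, x, y)"]) simp_all
    then show ?thesis by blast
  qed
  moreover have "B \<subseteq> (\<Union>k. f k)" unfolding f0[symmetric] by (rule UN_upper) simp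
  ultimately show ?thesis by (intro exI[of _ "\<Union>k. f k"] conjI allI ballI)
qed

text \<open>Labels carry only countable data; environments, sets and conditions are passed as
  arguments. So a countable set has a countable closure, and pairs of an operation and an element
  can be enumerated.\<close>

datatype opr =
    UpdC var
  | UpdO var nat
  | Sect "nat list"
  | Wit var fm
  | WitCov var fm
  | Comp "nat list" fm
  | CompCov "nat list" fm
  | Cover
  | Decide "nat list" fm
  | Choice "nat list" nat nat fm

instance opr :: countable by countable_datatype

text \<open>A common type allows one simultaneous closure. Conditions take part in it so that sets
  defined from a condition and an environment of the closure belong to it as well.\<close>

datatype thing = TE (env: "var \<Rightarrow> tv") | TC (con: "nat list set") | TP (cnd: cnd)

definition dflt :: "var \<Rightarrow> tv" where
  "dflt v = (case fst v of Obj \<Rightarrow> Ob 0 | Con k \<Rightarrow> Cn {})"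

lemma good_dflt: "{} \<in> U \<Longrightarrow> good U dflt"
  by (auto simp: good_def dflt_def split: sort.split)

text \<open>The interpretation of \<open>\<partial>\<close> does not matter for formulas without it; 0 serves there.\<close>

abbreviation sat0 :: "nat list set set \<Rightarrow> fm \<Rightarrow> (var \<Rightarrow> tv) \<Rightarrow> bool" where
  "sat0 U \<equiv> sat U (\<lambda>_. 0)"

abbreviation satc :: "cnd \<Rightarrow> fm \<Rightarrow> (var \<Rightarrow> tv) \<Rightarrow> bool" where
  "satc p \<equiv> sat (Cov (fst p)) (vals (fst p))"

abbreviation goodc :: "cnd \<Rightarrow> (var \<Rightarrow> tv) \<Rightarrow> bool" where
  "goodc p \<equiv> good (Cov (fst p))"

text \<open>The predicate handed to the fusion argument. Lists of the wrong length count as true, so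
  all lists can index instances; goodness of \<open>e\<close> is built in to make the predicate
  monotone in \<open>p\<close> for Sigma^1_1-formulas.\<close>

definition holds_at :: "nat list \<Rightarrow> fm \<Rightarrow> (var \<Rightarrow> tv) \<Rightarrow> (nat list set \<rightharpoonup> nat) \<Rightarrow> nat list \<Rightarrow> bool" where
  "holds_at xs A e p as \<longleftrightarrow>
     (length as = length xs \<longrightarrow> good (Cov p) e \<and> sat (Cov p) (vals p) A (oupd e xs as))"

definition witness :: "nat list \<Rightarrow> nat \<Rightarrow> nat \<Rightarrow> fm \<Rightarrow> cnd \<Rightarrow> (var \<Rightarrow> tv) \<Rightarrow> nat list \<Rightarrow> nat list set" where
  "witness xs q R A p e as = (SOME X. Cn X \<in> sdom (Cov (fst p)) (Con q) \<and>
     satc p A ((oupd e xs as)(cvar q R := Cn X)))"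

context equivalence
begin

definition decides :: "nat list \<Rightarrow> fm \<Rightarrow> (var \<Rightarrow> tv) \<Rightarrow> cnd \<Rightarrow> bool" where
  "decides xs A e q \<longleftrightarrow>
     (\<exists>as. \<forall>r. cond r \<longrightarrow> extends r q \<longrightarrow> \<not> holds_at xs A e (fst r) as) \<or>
     (\<forall>as. holds_at xs A e (fst q) as)"

text \<open>The universe of the model is obtained from a countable set closed under these operations:
  \<open>Wit\<close> provides Skolem functions for the full structure and \<open>WitCov\<close> those for the structures
  approximated by conditions.\<close>

definition apply_opr :: "opr \<Rightarrow> thing \<Rightarrow> thing \<Rightarrow> thing" where
  "apply_opr f x y = (case f of
     UpdC v \<Rightarrow> TE ((env x)(v := Cn (con y)))
   | UpdO v i \<Rightarrow> TE ((env x)(v := Ob i))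
   | Sect as \<Rightarrow> TC (sec (con x) as)
   | Wit v A \<Rightarrow> TC (SOME X. Cn X \<in> sdom UNIV (fst v) \<and> \<not> sat0 UNIV A ((env x)(v := Cn X)))
   | WitCov v A \<Rightarrow> TC (SOME X. Cn X \<in> sdom (Cov (fst (cnd x))) (fst v) \<and>
        satc (cnd x) A ((env y)(v := Cn X)))
   | Comp xs A \<Rightarrow> TC {as. length as = length xs \<and> sat0 UNIV A (oupd (env x) xs as)}
   | CompCov xs A \<Rightarrow> TC {as. length as = length xs \<and> satc (cnd x) A (oupd (env y) xs as)}
   | Cover \<Rightarrow> TP (SOME q. cond q \<and> extends q (cnd x) \<and> con y \<in> Cov (fst q))
   | Decide xs A \<Rightarrow> TP (SOME q. cond q \<and> extends q (cnd x) \<and> decides xs A (env y) q)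
   | Choice xs q R A \<Rightarrow> TC {as @ ys | as ys. length as = length xs \<and>
        ys \<in> witness xs q R A (cnd x) (env y) as})"

lemma holds_at_mono:
  assumes "sigma11 A" "wff L A" "p \<subseteq>\<^sub>m q" "holds_at xs A e p as"
  shows "holds_at xs A e q as"
  using assms(4) good_mono[OF _ Cov_mono[OF assms(3)]]
    sigma11_upward[OF assms(1,2) good_oupd sec_closed_Cov Cov_mono[OF assms(3)] map_le_vals[OF assms(3)]]
  by (auto simp: holds_at_def)

lemma ex_decides:
  assumes "cond p" "sigma11 A" "wff L A"
  shows "\<exists>q. cond q \<and> extends q p \<and> decides xs A e q"
proof -
  have "(\<exists>q. cond q \<and> extends q p \<and> (\<exists>as. \<forall>r. cond r \<longrightarrow> extends r q \<longrightarrow> \<not> holds_at xs A e (fst r) as))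
      \<or> (\<exists>q. cond q \<and> extends q p \<and> (\<forall>as. holds_at xs A e (fst q) as))"
    by (rule decide[OF assms(1)]) (rule holds_at_mono[OF assms(2,3)])
  then show ?thesis unfolding decides_def by blast
qed

lemma ex_generic:
  obtains M P where "\<And>f x y. x \<in> M \<Longrightarrow> y \<in> M \<Longrightarrow> apply_opr f x y \<in> M"
    and "TE dflt \<in> M" "TC {} \<in> M"
    and "\<And>k. cond (P k)" "\<And>k. extends (P (Suc k)) (P k)" "\<And>k. TP (P k) \<in> M"
    and "\<And>f y m. y \<in> M \<Longrightarrow> \<exists>k\<ge>m. \<forall>q. apply_opr f (TP (P k)) y = TP q \<longrightarrow> cond q \<longrightarrow>
      extends q (P k) \<longrightarrow> P (Suc k) = q"
proof -
  let ?p = "(Map.empty, UNIV) :: cnd"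
  obtain M where M: "countable M" "{TE dflt, TC {}, TP ?p} \<subseteq> M"
    "\<forall>i. \<forall>x\<in>M. \<forall>y\<in>M. apply_opr i x y \<in> M"
    using countable_closure[of "{TE dflt, TC {}, TP ?p}" apply_opr] by auto
  \<comment> \<open>\<open>k\<close> codes an operation, an element of \<open>M\<close> and a
    counter, which makes each such pair recur at arbitrarily late stages. A result that is not a
    condition in \<open>M\<close> extending \<open>p\<close> is discarded.\<close>
  define step where "step k p = (case prod_decode k of (i, l) \<Rightarrow> case prod_decode l of (j, m) \<Rightarrow>
      let q = cnd (apply_opr (from_nat i) (TP p) (from_nat_into M j)) in
      if TP q \<in> M \<and> cond q \<and> extends q p then q else p)" for k p
  define P where "P = rec_nat ?p step"
  have P0: "P 0 = ?p" and PS: "P (Suc k) = step k (P k)" for k by (simp_all add: P_def)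
  have step: "extends (step k p) p \<and> (cond p \<longrightarrow> cond (step k p)) \<and> (TP p \<in> M \<longrightarrow> TP (step k p) \<in> M)" for k p
    by (auto simp: step_def Let_def split: prod.split)
  have "cond ?p" by (simp add: cond_def faithful_def)
  then have 1: "cond (P k)" for k by (induction k) (auto simp: P0 PS step)
  have 2: "TP (P k) \<in> M" for k using M(2) by (induction k) (auto simp: P0 PS step)
  have 3: "\<exists>k\<ge>m. \<forall>q. apply_opr f (TP (P k)) y = TP q \<longrightarrow> cond q \<longrightarrow> extends q (P k) \<longrightarrow> P (Suc k) = q"
    if y: "y \<in> M" for f y m
  proof -
    define k where "k = prod_encode (to_nat f, prod_encode (to_nat_on M y, m))"
    have "m \<le> k" unfolding k_def using le_prod_encode_2 le_trans by blast
    moreover have "P (Suc k) = q"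
      if "apply_opr f (TP (P k)) y = TP q" "cond q" "extends q (P k)" for q
    proof -
      have "apply_opr f (TP (P k)) y \<in> M" using M(3) 2 y by blast
      then have "TP q \<in> M" unfolding that(1) .
      moreover have "from_nat_into M (to_nat_on M y) = y" by (rule from_nat_into_to_nat_on[OF M(1) y])
      moreover have "prod_decode k = (to_nat f, prod_encode (to_nat_on M y, m))" by (simp add: k_def)
      ultimately have "step k (P k) = q" using that by (simp add: step_def)
      then show ?thesis by (simp only: PS)
    qed
    ultimately show ?thesis by blast
  qed
  have "extends (P (Suc k)) (P k)" for k unfolding PS using step by blast
  note 4 = this
  show thesis
  proof (rule that[of M P])
    show "apply_opr f x y \<in> M" if "x \<in> M" "y \<in> M" for f x y using M(3) that by blast
      show "TE dflt \<in> M" "TC {} \<in> M" using M(2) by simp_all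
  qed (fact 1 4 2 3)+
qed

end

section \<open>The generic model: its universe and its abstraction operator\<close>

locale generic = equivalence +
  fixes M :: "thing set" and P :: "nat \<Rightarrow> cnd"
  assumes closed: "\<And>f x y. x \<in> M \<Longrightarrow> y \<in> M \<Longrightarrow> apply_opr f x y \<in> M"
    and dflt_M: "TE dflt \<in> M" and empty_M: "TC {} \<in> M"
    and cond_P: "\<And>k. cond (P k)" and extends_P: "\<And>k. extends (P (Suc k)) (P k)"
    and P_M: "\<And>k. TP (P k) \<in> M"
    and generic: "\<And>f y m. y \<in> M \<Longrightarrow> \<exists>k\<ge>m. \<forall>q. apply_opr f (TP (P k)) y = TP q \<longrightarrow> cond q \<longrightarrow>
      extends q (P k) \<longrightarrow> P (Suc k) = q"
begin

definition N :: "nat list set set" where "N = {X. TC X \<in> M}"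

definition D :: "nat list set \<rightharpoonup> nat" where "D = limit (\<lambda>k. fst (P k))"

abbreviation "ab \<equiv> vals D"

lemma fst_P_le: "fst (P k) \<subseteq>\<^sub>m fst (P (Suc k))"
  using extends_P by (simp add: extends_def)

lemma extends_P_le: "k \<le> l \<Longrightarrow> extends (P l) (P k)"
  by (induction rule: dec_induct) (auto intro: extends_trans extends_P)

lemma P_le_D: "fst (P k) \<subseteq>\<^sub>m D"
  unfolding D_def by (rule limit_upper[of "\<lambda>k. fst (P k)", OF fst_P_le])

lemma Cov_agree: "\<forall>X\<in>Cov (fst (P k)). vals (fst (P k)) X = ab X"
  by (rule map_le_vals[OF P_le_D])

lemma faithful_D: "faithful D"
  unfolding D_def by (rule faithful_limit) (use fst_P_le cond_P in \<open>auto simp: cond_def\<close>)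

lemma empty_N: "{} \<in> N"
  using empty_M by (simp add: N_def)

lemma sec_closed_N: "sec_closed N"
  unfolding sec_closed_def
proof (intro ballI allI)
  fix X as assume "X \<in> N"
  then have "apply_opr (Sect as) (TC X) (TC X) \<in> M" by (intro closed) (simp_all add: N_def)
  then show "sec X as \<in> N" by (simp add: apply_opr_def N_def)
qed

lemma UpdC_M: "TE e \<in> M \<Longrightarrow> X \<in> N \<Longrightarrow> TE (e(v := Cn X)) \<in> M"
  using closed[of "TE e" "TC X" "UpdC v"] by (simp add: apply_opr_def N_def)

lemma UpdO_M: "TE e \<in> M \<Longrightarrow> TE (e(v := Ob i)) \<in> M"
  using closed[of "TE e" "TE e" "UpdO v i"] by (simp add: apply_opr_def)

lemma upd_M: "TE e \<in> M \<Longrightarrow> d \<in> sdom N s \<Longrightarrow> TE (e(v := d)) \<in> M"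
  by (cases s) (auto intro: UpdC_M UpdO_M)

lemma oupd_M: "TE e \<in> M \<Longrightarrow> TE (oupd e xs as) \<in> M"
  by (induction e xs as rule: oupd.induct) (auto intro: UpdO_M)

text \<open>By genericity \<open>Cover\<close> is carried out for \<open>X\<close> at some stage,
  and later conditions cover at least as much.\<close>

lemma covered: "X \<in> N \<Longrightarrow> \<exists>m. \<forall>k\<ge>m. X \<in> Cov (fst (P k))"
proof -
  assume X: "X \<in> N"
  then obtain k where k: "\<forall>q. apply_opr Cover (TP (P k)) (TC X) = TP q \<longrightarrow> cond q \<longrightarrow>
      extends q (P k) \<longrightarrow> P (Suc k) = q"
    using generic[of "TC X" 0 Cover] by (auto simp: N_def)
  have "\<exists>q. cond q \<and> extends q (P k) \<and> X \<in> Cov (fst q)" by (rule cover[OF cond_P])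
  from someI_ex[OF this] have "X \<in> Cov (fst (P (Suc k)))" using k by (auto simp: apply_opr_def)
  then have "\<forall>l\<ge>Suc k. X \<in> Cov (fst (P l))"
    using extends_P_le Cov_mono unfolding extends_def by blast
  then show ?thesis by blast
qed

lemma N_dom_D: "X \<in> N \<Longrightarrow> X \<in> dom D"
  using covered Cov_dom map_le_implies_dom_le[OF P_le_D] by blast

lemma ab_eq_iff: "X \<in> N \<Longrightarrow> Y \<in> N \<Longrightarrow> ab X = ab Y \<longleftrightarrow> EE X Y"
proof -
  assume "X \<in> N" "Y \<in> N"
  then obtain i j where "D X = Some i" "D Y = Some j" using N_dom_D unfolding dom_def by blast
  then show ?thesis using faithful_D by (simp add: faithful_def vals_def)
qed

lemma goodc_upd:
  assumes "\<forall>k\<ge>m. goodc (P k) e" "d \<in> sdom N (fst v)"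
  shows "\<exists>m'. \<forall>k\<ge>m'. goodc (P k) (e(v := d))"
proof -
  have "\<exists>l. \<forall>k\<ge>l. d \<in> sdom (Cov (fst (P k))) (fst v)"
  proof (cases "fst v")
    case (Con q)
    then obtain X where X: "d = Cn X" "X \<in> N" "\<forall>l\<in>X. length l = q" using assms(2) by auto
    then obtain l where "\<forall>k\<ge>l. X \<in> Cov (fst (P k))" using covered by blast
    then show ?thesis using X Con by auto
  qed (use assms(2) in auto)
  then obtain l where "\<forall>k\<ge>l. d \<in> sdom (Cov (fst (P k))) (fst v)" by blast
  then have "\<forall>k\<ge>max l m. goodc (P k) (e(v := d))" using assms(1) good_upd by simp
  then show ?thesis by blast
qed

text \<open>\<open>M\<close> contains only finite modifications of \<open>dflt\<close>, which suffices since a formula has finitely many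
  free variables.\<close>

lemma ex_env:
  assumes "finite V" "good N e"
  shows "\<exists>e' m. TE e' \<in> M \<and> (\<forall>v\<in>V. e' v = e v) \<and> good N e' \<and> (\<forall>k\<ge>m. goodc (P k) e')"
  using assms(1)
proof (induction V)
  case empty
  obtain m where m: "\<forall>k\<ge>m. {} \<in> Cov (fst (P k))" using covered[OF empty_N] by blast
  then have "\<forall>k\<ge>m. goodc (P k) dflt" using good_dflt by blast
  then show ?case using dflt_M good_dflt[OF empty_N] by blast
next
  case (insert v V)
  then obtain e' m where e': "TE e' \<in> M" "\<forall>v\<in>V. e' v = e v" "good N e'" "\<forall>k\<ge>m. goodc (P k) e'"
    by blast
  have d: "e v \<in> sdom N (fst v)" using assms(2) unfolding good_def by blast
  obtain m' where "\<forall>k\<ge>m'. goodc (P k) (e'(v := e v))" using goodc_upd[OF e'(4) d] by blast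
  moreover have "TE (e'(v := e v)) \<in> M" using upd_M[OF e'(1) d] .
  moreover have "good N (e'(v := e v))" using good_upd[OF e'(3) d] .
  moreover have "\<forall>u\<in>insert v V. (e'(v := e v)) u = e u" using e'(2) by simp
  ultimately show ?case by blast
qed

section \<open>Elementarity in the full structure\<close>

lemma elementary_M:
  assumes "TE e \<in> M" "good N e"
  shows "sat0 N A e \<longleftrightarrow> sat0 UNIV A e"
  using assms
proof (induction A arbitrary: e)
  case (Forall v A)
  have IH: "sat0 N A (e(v := d)) \<longleftrightarrow> sat0 UNIV A (e(v := d))" if "d \<in> sdom N (fst v)" for d
    using Forall.IH[OF upd_M[OF Forall.prems(1) that] good_upd[OF Forall.prems(2) that]] .
  \<comment> \<open>The Tarski-Vaught test: \<open>Wit\<close> chooses a refuting concept from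
    \<open>e\<close>, which lies in \<open>M\<close>, so the concept lies in
    \<open>N\<close>.\<close>
  have "\<exists>d\<in>sdom N (fst v). \<not> sat0 UNIV A (e(v := d))"
    if d: "d \<in> sdom UNIV (fst v)" "\<not> sat0 UNIV A (e(v := d))" for d
  proof (cases "fst v")
    case Obj
    then show ?thesis using d by auto
  next
    case (Con k)
    let ?Q = "\<lambda>X. Cn X \<in> sdom UNIV (fst v) \<and> \<not> sat0 UNIV A (e(v := Cn X))"
    have "\<exists>X. ?Q X" using d Con by auto
    then have Q: "?Q (SOME X. ?Q X)" by (rule someI_ex)
    moreover have "(SOME X. ?Q X) \<in> N"
      using closed[OF Forall.prems(1) Forall.prems(1), of "Wit v A"] by (simp add: apply_opr_def N_def)
    ultimately have "Cn (SOME X. ?Q X) \<in> sdom N (fst v)" using Con by auto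
    then show ?thesis using Q by blast
  qed
  then show ?case using IH sdom_mono[of N UNIV "fst v"] by auto
qed simp_all

lemma elementary:
  assumes "wff L A" "abstr_arity L = None" "good N e"
  shows "sat N ab A e \<longleftrightarrow> sat0 UNIV A e"
proof -
  obtain e' where e': "TE e' \<in> M" "\<forall>v\<in>fv A. e' v = e v" "good N e'"
    using ex_env[OF finite_fv assms(3)] by blast
  have "sat N ab A e \<longleftrightarrow> sat0 N A e" using sat_abstr_free[OF assms(1,2)] .
  also have "\<dots> \<longleftrightarrow> sat0 N A e'" using e' by (intro sat_cong) simp
  also have "\<dots> \<longleftrightarrow> sat0 UNIV A e'" using elementary_M e' by blast
  also have "\<dots> \<longleftrightarrow> sat0 UNIV A e" using e' by (intro sat_cong) simp
  finally show ?thesis .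
qed

section \<open>Comprehension in the generic model\<close>

lemma full_comprehension_N:
  assumes "wff L A" "abstr_arity L = None" "good N e"
  shows "{as. length as = length xs \<and> sat N ab A (oupd e xs as)} \<in> N"
proof -
  obtain e' where e': "TE e' \<in> M" "\<forall>v\<in>fv A. e' v = e v" "good N e'"
    using ex_env[OF finite_fv assms(3)] by blast
  have "sat N ab A (oupd e xs as) \<longleftrightarrow> sat0 UNIV A (oupd e' xs as)" for as
  proof -
    have "sat N ab A (oupd e xs as) \<longleftrightarrow> sat0 UNIV A (oupd e xs as)"
      using elementary[OF assms(1,2) good_oupd[OF assms(3)]] .
    also have "\<dots> \<longleftrightarrow> sat0 UNIV A (oupd e' xs as)"
      using e'(2) by (intro sat_cong oupd_agree[of "fv A"]) auto
    finally show ?thesis .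
  qed
  then show ?thesis
    using closed[OF e'(1) e'(1), of "Comp xs A"] by (simp add: apply_opr_def N_def)
qed

lemma first_order_comprehension_N:
  assumes "wff L A" "first_order A" "good N e"
  shows "{as. length as = length xs \<and> sat N ab A (oupd e xs as)} \<in> N"
proof -
  obtain e' m where e': "TE e' \<in> M" "\<forall>v\<in>fv A. e' v = e v" "\<forall>k\<ge>m. goodc (P k) e'"
    using ex_env[OF finite_fv assms(3)] by blast
  have "sat N ab A (oupd e xs as) \<longleftrightarrow> satc (P m) A (oupd e' xs as)" for as
  proof -
    have "sat N ab A (oupd e xs as) \<longleftrightarrow> sat N ab A (oupd e' xs as)"
      using e'(2) by (intro sat_cong oupd_agree[of "fv A"]) auto
    also have "\<dots> \<longleftrightarrow> satc (P m) A (oupd e' xs as)"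
      using first_order_absolute[OF assms(2,1) good_oupd sec_closed_Cov Cov_agree] e'(3) by blast
    finally show ?thesis .
  qed
  then show ?thesis
    using closed[OF P_M[of m] e'(1), of "CompCov xs A"] by (simp add: apply_opr_def N_def)
qed

section \<open>Sigma^1_1-formulas and choice in the generic model\<close>

lemma sigma11_N_imp_cond:
  assumes "sigma11 A" "wff L A" "sat N ab A e" "\<forall>k\<ge>m. goodc (P k) e"
  shows "\<exists>l. \<forall>k\<ge>l. satc (P k) A e"
  using assms
proof (induction arbitrary: e m)
  case (1 A)
  then have "\<forall>k\<ge>m. satc (P k) A e"
    using first_order_absolute[OF _ _ _ sec_closed_Cov Cov_agree] by blast
  then show ?case by blast
next
  case (2 A k R)
  then obtain d where d: "d \<in> sdom N (Con k)" "sat N ab A (e(cvar k R := d))" by auto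
  obtain m' where m': "\<forall>j\<ge>m'. goodc (P j) (e(cvar k R := d))"
    using goodc_upd[OF "2.prems"(3), of d "cvar k R"] d(1) by auto
  then obtain l where l: "\<forall>j\<ge>l. satc (P j) A (e(cvar k R := d))"
    using "2.IH"[OF _ d(2) m'] "2.prems"(1) unfolding wff_connectives by blast
  have "d \<in> sdom (Cov (fst (P j))) (Con k)" if "j \<ge> m'" for j
  proof -
    have "(e(cvar k R := d)) (cvar k R) \<in> sdom (Cov (fst (P j))) (fst (cvar k R))"
      using m' that unfolding good_def by blast
    then show ?thesis by simp
  qed
  then have "\<forall>j\<ge>max l m'. satc (P j) (Exists (cvar k R) A) e"
    using l unfolding sat_connectives fst_conv by (meson max.bounded_iff)
  then show ?case by blast
qed

text \<open>Sets covered by \<open>P k\<close> are not assumed to lie in \<open>N\<close>, so the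
  witness is the one that \<open>WitCov\<close> picks from \<open>P k\<close> and \<open>e\<close>,
  both in \<open>M\<close>.\<close>

lemma sigma11_cond_imp_N:
  assumes "sigma11 A" "wff L A" "satc (P k) A e" "goodc (P k) e" "TE e \<in> M"
  shows "sat N ab A e"
  using assms
proof (induction arbitrary: e)
  case (1 A)
  then show ?case using first_order_absolute[OF _ _ _ sec_closed_Cov Cov_agree] by blast
next
  case (2 A q R)
  let ?v = "cvar q R"
  let ?Q = "\<lambda>X. Cn X \<in> sdom (Cov (fst (P k))) (fst ?v) \<and> satc (P k) A (e(?v := Cn X))"
  define X where "X = (SOME X. ?Q X)"
  have "\<exists>X. ?Q X" using "2.prems"(2) by auto
  then have Q: "?Q X" unfolding X_def by (rule someI_ex)
  have X: "X \<in> N"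
    using closed[OF P_M[of k] "2.prems"(4), of "WitCov ?v A"] by (simp add: apply_opr_def N_def X_def)
  have "sat N ab A (e(?v := Cn X))"
    using "2.IH" "2.prems" Q good_upd[of _ e "Cn X" ?v] UpdC_M[OF "2.prems"(4) X] by auto
  moreover have "Cn X \<in> sdom N (fst ?v)" using X Q by auto
  ultimately show ?case unfolding sat_connectives by blast
qed

text \<open>Different instances might need later and later conditions. Deciding them all at one
  stage brings the witnesses under a single condition of \<open>M\<close>, from which the choice
  function is definable.\<close>

lemma sat_choice_instance:
  assumes "q \<ge> 1" "xs \<noteq> []" "distinct xs" "wff L A" "sigma11 A"
    and R: "cvar (length xs + q) R \<notin> fv A" and e: "good N e"
  shows "sat N ab (choice_instance q R R' xs A) e"
proof -
  let ?r = "cvar (length xs + q) R" and ?r' = "cvar q R'"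
  let ?B = "Exists ?r' A"
  have B: "sigma11 ?B" "wff L ?B" using assms by (auto intro: sigma11.intros)
  have "\<exists>Z\<in>sdom N (fst ?r). sat N ab
      (Foralls (ovars xs) (subst1 A ?r' (Section (Var ?r) (oterms xs)))) (e(?r := Z))"
    if hyp: "sat N ab (Foralls (ovars xs) ?B) e"
  proof -
    obtain e' m where e': "TE e' \<in> M" "\<forall>v\<in>fv A. e' v = e v" "good N e'" "\<forall>k\<ge>m. goodc (P k) e'"
      using ex_env[OF finite_fv e] by blast
    have ee': "oupd e' xs as v = oupd e xs as v" if "v \<in> fv A" for v as
      using oupd_agree[OF e'(2) that] .
    have NB: "sat N ab ?B (oupd e' xs as)" if "length as = length xs" for as
    proof -
      have "sat N ab ?B (oupd e xs as)" using hyp that unfolding sat_Foralls_ovars by blast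
      moreover have "sat N ab ?B (oupd e xs as) = sat N ab ?B (oupd e' xs as)"
        using ee' by (intro sat_cong) simp
      ultimately show ?thesis by simp
    qed
    obtain k where k: "k \<ge> m" "\<forall>q. apply_opr (Decide xs ?B) (TP (P k)) (TE e') = TP q \<longrightarrow> cond q \<longrightarrow>
      extends q (P k) \<longrightarrow> P (Suc k) = q"
      using generic[OF e'(1)] by blast
    have "decides xs ?B e' (P (Suc k))"
      using someI_ex[OF ex_decides[OF cond_P[of k] B, of xs e']] k(2) by (simp add: apply_opr_def)
    \<comment> \<open>This rules out an excluded instance: each instance is true in
      \<open>N\<close>, hence under a later condition of the sequence.\<close>
    moreover have "\<exists>r. cond r \<and> extends r (P (Suc k)) \<and> holds_at xs ?B e' (fst r) as" for as
    proof (cases "length as = length xs")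
      case True
      have "\<forall>k\<ge>m. goodc (P k) (oupd e' xs as)" using e'(4) good_oupd by blast
      then obtain l where l: "\<forall>k\<ge>l. satc (P k) ?B (oupd e' xs as)"
        using sigma11_N_imp_cond[OF B NB[OF True]] by blast
      let ?j = "max l (max m (Suc k))"
      have "holds_at xs ?B e' (fst (P ?j)) as" unfolding holds_at_def using l e'(4) by auto
      moreover have "extends (P ?j) (P (Suc k))" by (rule extends_P_le) simp
      ultimately show ?thesis using cond_P by blast
    next
      case False
      then show ?thesis using cond_P extends_refl unfolding holds_at_def by blast
    qed
    ultimately have hold: "holds_at xs ?B e' (fst (P (Suc k))) as" for as
      unfolding decides_def by blast
    define p where "p = P (Suc k)"
    define Z where "Z = witness xs q R' A p e'"
    \<comment> \<open>All witnesses come from the one condition \<open>p\<close>, so the glued set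
      is a value of \<open>Choice\<close> and lies in \<open>N\<close>.\<close>
    define W where "W = {as @ ys | as ys. length as = length xs \<and> ys \<in> Z as}"
    have W: "W \<in> N"
      using closed[OF P_M[of "Suc k"] e'(1), of "Choice xs q R' A"]
      by (simp add: apply_opr_def N_def W_def Z_def p_def)
    have Z: "Cn (Z as) \<in> sdom (Cov (fst p)) (Con q) \<and> satc p A ((oupd e' xs as)(?r' := Cn (Z as)))"
      if "length as = length xs" for as
    proof -
      have "\<exists>d\<in>sdom (Cov (fst p)) (Con q). satc p A ((oupd e' xs as)(?r' := d))"
        using hold[of as] that by (simp add: holds_at_def p_def)
      then have "\<exists>X. Cn X \<in> sdom (Cov (fst p)) (Con q) \<and> satc p A ((oupd e' xs as)(?r' := Cn X))"
        by auto
      from someI_ex[OF this] show ?thesis unfolding Z_def witness_def .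
    qed
    have sec: "sec W as = Z as" if "length as = length xs" for as
      using that by (auto simp: sec_def W_def)
    have "length l = length xs + q" if lW: "l \<in> W" for l
    proof -
      obtain as ys where "l = as @ ys" "length as = length xs" "ys \<in> Z as" using lW by (auto simp: W_def)
      then show ?thesis using Z[of as] by auto
    qed
    then have WN: "Cn W \<in> sdom N (fst ?r)" using W by auto
    have "sat N ab (subst1 A ?r' (Section (Var ?r) (oterms xs))) (oupd (e(?r := Cn W)) xs as)"
      if l: "length as = length xs" for as
    proof -
      let ?e = "(oupd e' xs as)(?r' := Cn (Z as))"
      \<comment> \<open>So far \<open>Z as\<close> was only known to be covered by \<open>p\<close>;
        being a section of \<open>W\<close> puts it into \<open>N\<close>.\<close>
      have ZN: "Z as \<in> N" using sec_closed_N W sec[OF l] by (metis sec_closed_def)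
      have "goodc p e'" using e'(4) k(1) by (simp add: p_def)
      then have "goodc p ?e" using Z[OF l] by (intro good_upd good_oupd) simp_all
      then have "sat N ab A ?e"
        using sigma11_cond_imp_N[OF assms(5,4), of "Suc k" ?e] Z[OF l] UpdC_M[OF oupd_M[OF e'(1)] ZN]
        unfolding p_def by blast
      moreover have upd: "oupd (e(?r := Cn W)) xs as = (oupd e xs as)(?r := Cn W)"
        by (rule oupd_upd) auto
      moreover have "val ab ((oupd e xs as)(?r := Cn W)) (Section (Var ?r) (oterms xs)) = Cn (Z as)"
        using oupd_oterms[OF assms(3) l[symmetric], of ab "e(?r := Cn W)"] sec[OF l] unfolding upd
        by (simp del: map_map)
      moreover have "sat N ab A ?e = sat N ab A ((oupd e xs as)(?r := Cn W, ?r' := Cn (Z as)))"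
        using R ee' by (intro sat_cong) auto
      ultimately show ?thesis unfolding sat_subst1 by simp
    qed
    then show ?thesis using WN unfolding sat_Foralls_ovars by blast
  qed
  then show ?thesis unfolding choice_instance_def Let_def by simp
qed

end

section \<open>The equivalence relation defined by \<open>E\<close>\<close>

lemma sat_SO_GC_full: "A \<in> SO_GC \<Longrightarrow> good UNIV e \<Longrightarrow> sat UNIV ab A e"
  unfolding SO_GC_def using sat_SO[of A sig_SO_GC UNIV e ab] sat_GC by blast

text \<open>Conditions assign values to sets of lists of mixed lengths; cutting down to length \<open>n\<close> extends
  the relation defined by \<open>E\<close> to an equivalence relation on all of them.\<close>

definition arity_part :: "nat \<Rightarrow> nat list set \<Rightarrow> nat list set" where
  "arity_part n X = {l \<in> X. length l = n}"

definition defined_rel :: "nat \<Rightarrow> nat \<Rightarrow> nat \<Rightarrow> fm \<Rightarrow> tv \<Rightarrow> tv \<Rightarrow> bool" where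
  "defined_rel n R S E d d' \<longleftrightarrow> sat0 UNIV E (dflt(cvar n R := d, cvar n S := d'))"

lemma defined_rel_eq:
  assumes "fv E = {cvar n R, cvar n S}" "R \<noteq> S"
  shows "sat0 UNIV E e \<longleftrightarrow> defined_rel n R S E (e (cvar n R)) (e (cvar n S))"
  unfolding defined_rel_def using assms by (intro sat_cong) auto

lemma sat_app2:
  assumes "fv E = {cvar n R, cvar n S}" "R \<noteq> S"
  shows "sat0 UNIV (app2 n R S E t u) e \<longleftrightarrow> defined_rel n R S E (val (\<lambda>_. 0) e t) (val (\<lambda>_. 0) e u)"
  unfolding app2_def sat_subst defined_rel_eq[OF assms] using assms(2) by simp

text \<open>Soundness makes the provable equivalence true in the full structure. The resulting
  relation on \<open>n\<close>-ary sets is pulled back along \<open>arity_part n\<close>.\<close>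

lemma equivp_defined_rel:
  assumes "fv E = {cvar n R, cvar n S}" "R \<noteq> S"
    and "proves sig_SO_GC SO_GC (equivalence_fm n R S E)"
  shows "equivp (\<lambda>X Y. defined_rel n R S E (Cn (arity_part n X)) (Cn (arity_part n Y)))"
proof -
  let ?r = "defined_rel n R S E" and ?D = "sdom UNIV (Con n)"
  have "sat0 UNIV (equivalence_fm n R S E) dflt"
    by (rule soundness[OF assms(3) _ sat_SO_GC_full]) (simp_all add: sec_closed_def good_dflt)
  then have "(\<forall>x\<in>?D. ?r x x) \<and> (\<forall>x\<in>?D. \<forall>y\<in>?D. ?r x y \<longrightarrow> ?r y x) \<and>
      (\<forall>x\<in>?D. \<forall>y\<in>?D. \<forall>z\<in>?D. ?r x y \<and> ?r y z \<longrightarrow> ?r x z)"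
    unfolding equivalence_fm_def Let_def Foralls_def foldr.simps comp_apply id_apply sat_connectives
      sat.simps fst_conv sat_app2[OF assms(1,2)] val.simps
    by (simp (no_asm_use) del: sdom.simps, assumption?)
  then have r: "\<And>x. x \<in> ?D \<Longrightarrow> ?r x x" "\<And>x y. x \<in> ?D \<Longrightarrow> y \<in> ?D \<Longrightarrow> ?r x y \<Longrightarrow> ?r y x"
    "\<And>x y z. x \<in> ?D \<Longrightarrow> y \<in> ?D \<Longrightarrow> z \<in> ?D \<Longrightarrow> ?r x y \<Longrightarrow> ?r y z \<Longrightarrow> ?r x z"
    by blast+
  have D: "Cn (arity_part n X) \<in> ?D" for X by (auto simp: arity_part_def)
  show ?thesis
    by (rule equivpI; (rule reflpI | rule sympI | rule transpI))
      (rule r(1)[OF D], erule r(2)[OF D D], erule (1) r(3)[OF D D D])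
qed

text \<open>By elementarity \<open>E\<close> may be evaluated in the full structure, where on
  \<open>n\<close>-ary sets it is the relation that the conditions respect.\<close>

lemma sat_abstraction_axiom:
  assumes "generic (\<lambda>X Y. defined_rel n R S E (Cn (arity_part n X)) (Cn (arity_part n Y))) M P"
    and "wff sig_SO_GC E" "fv E = {cvar n R, cvar n S}" "R \<noteq> S"
    and e: "good (generic.N M) e"
  shows "sat (generic.N M) (vals (generic.D P)) (abstraction_axiom n R S E) e"
proof -
  interpret generic "\<lambda>X Y. defined_rel n R S E (Cn (arity_part n X)) (Cn (arity_part n Y))" M P by fact
  have "ab X = ab Y \<longleftrightarrow> sat N ab E (e(cvar n R := Cn X, cvar n S := Cn Y))"
    if X: "X \<in> N" "\<forall>l\<in>X. length l = n" and Y: "Y \<in> N" "\<forall>l\<in>Y. length l = n" for X Y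
  proof -
    let ?e = "e(cvar n R := Cn X, cvar n S := Cn Y)"
    have "good N ?e" using e X Y by (intro good_upd) auto
    then have "sat N ab E ?e \<longleftrightarrow> sat0 UNIV E ?e"
      using elementary[OF assms(2)] by (simp add: sig_SO_GC_def)
    also have "\<dots> \<longleftrightarrow> defined_rel n R S E (Cn X) (Cn Y)"
      unfolding defined_rel_eq[OF assms(3,4)] using assms(4) by simp
    also have "\<dots> \<longleftrightarrow> defined_rel n R S E (Cn (arity_part n X)) (Cn (arity_part n Y))"
    proof -
      have "arity_part n X = X" "arity_part n Y = Y" using X Y by (auto simp: arity_part_def)
      then show ?thesis by simp
    qed
    finally show ?thesis using ab_eq_iff X Y by simp
  qed
  then show ?thesis using assms(4) by (auto simp: abstraction_axiom_def Foralls_def)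
qed

theorem theorem3p3:
  fixes n R S :: nat and E :: fm
  assumes "n \<ge> 1"
    and "wff sig_SO_GC E"
    and "R \<noteq> S"
    and "fv E = {cvar n R, cvar n S}"
    and "proves sig_SO_GC SO_GC (equivalence_fm n R S E)"
  shows "consistent (sig_full n) (sigma11_A_SO_GC n R S E)"
proof -
  let ?EE = "\<lambda>X Y. defined_rel n R S E (Cn (arity_part n X)) (Cn (arity_part n Y))"
  interpret equivalence ?EE
    by unfold_locales (rule equivp_defined_rel[OF assms(4,3,5)])
  obtain M P where gen: "generic ?EE M P"
    using ex_generic equivalence_axioms unfolding generic_def generic_axioms_def by metis
  interpret generic ?EE M P by (rule gen)
  have ax: "sat N ab A e" if A: "A \<in> sigma11_A_SO_GC n R S E" and e: "good N e" for A e
  proof -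
    consider "A = abstraction_axiom n R S E" | "A \<in> fo_comprehension (sig_full n)"
      | "A \<in> sigma11_choice (sig_full n)" | "A \<in> SO sig_SO_GC" | "A \<in> GC (sig_full n)"
      using A unfolding sigma11_A_SO_GC_def sigma11_A_def by blast
    then show ?thesis
    proof cases
      case 1
      show ?thesis unfolding 1 by (rule sat_abstraction_axiom[OF gen assms(2,4,3) e])
    next
      case 2
      then obtain Q xs B where Q: "A = comprehension_instance Q xs B" "distinct xs"
        "wff (sig_full n) B" "first_order B" "cvar (length xs) Q \<notin> fv B"
        unfolding fo_comprehension_def by blast
      show ?thesis unfolding Q(1)
        by (rule sat_comprehension[OF Q(2,5) first_order_comprehension_N[OF Q(3,4) e]])
    next
      case 3
      then obtain q Q Q' xs B where Q: "A = choice_instance q Q Q' xs B" "q \<ge> 1" "xs \<noteq> []"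
        "distinct xs" "wff (sig_full n) B" "sigma11 B" "cvar (length xs + q) Q \<notin> fv B"
        unfolding sigma11_choice_def by blast
      show ?thesis unfolding Q(1) by (rule sat_choice_instance[OF Q(2-7) e])
    next
      case 4
      \<comment> \<open>These comprehension formulas do not contain \<open>\<partial>\<close>, so
        their extensions come from elementarity.\<close>
      have "abstr_arity sig_SO_GC = None" by (simp add: sig_SO_GC_def)
      then show ?thesis using sat_SO[OF 4 e] full_comprehension_N by blast
    next
      case 5
      then show ?thesis by (rule sat_GC)
    qed
  qed
  show ?thesis
    unfolding consistent_def
  proof
    assume "proves (sig_full n) (sigma11_A_SO_GC n R S E) Fls"
    then have "sat N ab Fls dflt"
      by (rule soundness[OF _ sec_closed_N ax good_dflt[OF empty_N]])
    then show False by simp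
  qed
qed

end
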